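(* Let $(k,|\cdot|_k)$ be a non-Archimedean field (of arbitrary characteristic), let $\overline k$ be an algebraic closure of $k$, and let $\widehat{\overline k}$ be the completion of $\overline k$ with respect to the unique extension of $|\cdot|_k$ to $\overline k$. Then for every integer $n>0$, $T_n(\widehat{\overline k})$ is an intersection flat $T_n(k)$-algebra, i.e. it is intersection flat as a $T_n(k)$-module.
   Context: A non-Archimedean (NA) field is a field $k$ with a function $|\cdot|:k\to\mathbb{R}_{\ge 0}$ satisfying $|x|=0\iff x=0$, $|xy|=|x||y|$, $|x+y|\le\max\{|x|,|y|\}$, such that $k$ is complete for the induced metric and $|k^\times|\ne\{1\}$. For a NA field $k$, the Tate algebra $T_n(k)$ is the subring of $k\llbracket X_1,\dots,X_n\rrbracket$ of power series $\sum_{\nu\in\mathbb{Z}_{\ge0}^n}a_\nu X^\nu$ with $|a_\nu|\to0$ as $\nu_1+\dots+\nu_n\to\infty$. For $R$-modules $L,M$ and a submodule $U\subseteq L$, $UM$ denotes the image of $U\otimes_RM\to L\otimes_RM$. An $R$-module $M$ is intersection flat if for every finitely generated $R$-module $L$ and every collection $\{U_i\}_i$ of submodules of $L$, $(\bigcap_iU_i)M=\bigcap_i(U_iM)$. *)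

theory Defs
  imports
    "HOL-Analysis.Analysis"
    "HOL-Algebra.Module"
    "HOL-Algebra.Free_Abelian_Groups"
    "HOL-Computational_Algebra.Polynomial"
begin

section \<open>Non-Archimedean fields\<close>

text \<open>
  The metric, and hence topology and completeness, is the one induced by the absolute value, which
  is therefore nonnegative.  The class \<open>na_valued_field\<close> asks neither for completeness nor for a
  nontrivial value group, so that it also covers an algebraic closure of a non-Archimedean field.
  (The library's \<open>norm\<close> is constrained to real normed vector spaces.)
\<close>

class na_valued_field = field + metric_space +
  fixes na_abs :: "'a \<Rightarrow> real"
  assumes dist_na_abs: "dist x y = na_abs (x - y)"
    and na_abs_eq_0_iff: "na_abs x = 0 \<longleftrightarrow> x = 0"
    and na_abs_mult: "na_abs (x * y) = na_abs x * na_abs y"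
    and na_abs_add_le: "na_abs (x + y) \<le> max (na_abs x) (na_abs y)"

class na_field = na_valued_field + complete_space +
  assumes na_abs_nontrivial: "\<exists>x. x \<noteq> 0 \<and> na_abs x \<noteq> 1"

definition field_hom :: "('a::field \<Rightarrow> 'b::field) \<Rightarrow> bool" where
  "field_hom \<phi> \<longleftrightarrow> \<phi> 1 = 1 \<and> (\<forall>x y. \<phi> (x + y) = \<phi> x + \<phi> y) \<and> (\<forall>x y. \<phi> (x * y) = \<phi> x * \<phi> y)"

definition is_algebraic_closure :: "('k::field \<Rightarrow> 'a::alg_closed_field) \<Rightarrow> bool" where
  "is_algebraic_closure \<iota> \<longleftrightarrow>
     field_hom \<iota> \<and> (\<forall>y. \<exists>p. p \<noteq> 0 \<and> poly (map_poly \<iota> p) y = 0)"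

definition is_completion ::
  "('a::na_valued_field \<Rightarrow> 'c::{na_valued_field, complete_space}) \<Rightarrow> bool" where
  "is_completion \<kappa> \<longleftrightarrow>
     field_hom \<kappa> \<and> (\<forall>x. na_abs (\<kappa> x) = na_abs x) \<and> closure (range \<kappa>) = UNIV"


section \<open>Power series and Tate algebras\<close>

text \<open>
  Exponents are finitely supported functions from \<^typ>\<open>nat\<close> to \<^typ>\<open>nat\<close>; those with support in
  \<open>{..<n}\<close> are the exponents in \<open>n\<close> variables.  A power series is its coefficient function,
  extended by zero to the exponents that involve further variables.  In the product, an exponent
  has only finitely many decompositions \<open>\<alpha> + \<beta>\<close>, so the sum is finite.
\<close>

type_synonym 'k mseries = "(nat \<Rightarrow>\<^sub>0 nat) \<Rightarrow> 'k"

definition power_series_ring :: "nat \<Rightarrow> 'k::field mseries ring" where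
  "power_series_ring n =
     \<lparr>carrier = {a. \<forall>\<nu>. \<not> Poly_Mapping.keys \<nu> \<subseteq> {..<n} \<longrightarrow> a \<nu> = 0},
      monoid.mult = (\<lambda>a b \<nu>. \<Sum>(\<alpha>, \<beta>) | \<alpha> + \<beta> = \<nu>. a \<alpha> * b \<beta>),
      monoid.one = (\<lambda>\<nu>. if \<nu> = 0 then 1 else 0),
      ring.zero = (\<lambda>\<nu>. 0),
      ring.add = (\<lambda>a b \<nu>. a \<nu> + b \<nu>)\<rparr>"

text \<open>Convergence along the filter below means convergence as \<open>\<nu>\<^sub>1 + \<dots> + \<nu>\<^sub>n \<rightarrow> \<infinity>\<close>.\<close>

definition tate_ring :: "nat \<Rightarrow> 'k::na_field mseries ring" where
  "tate_ring n = power_series_ring n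
     \<lparr>carrier := {a \<in> carrier (power_series_ring n).
        ((\<lambda>\<nu>. na_abs (a \<nu>)) \<longlongrightarrow> 0)
          (filtercomap (\<lambda>\<nu>. \<Sum>i<n. Poly_Mapping.lookup \<nu> i) at_top)}\<rparr>"

text \<open>
  For an embedding \<open>\<phi>\<close> of valued fields, the Tate algebra over the target, regarded as an algebra
  over the Tate algebra of the source by applying \<open>\<phi>\<close> to coefficients.
\<close>

definition tate_algebra ::
  "nat \<Rightarrow> ('k::na_field \<Rightarrow> 'c::na_field) \<Rightarrow> ('k mseries, 'c mseries) module" where
  "tate_algebra n \<phi> =
     \<lparr>carrier = carrier (tate_ring n),
      monoid.mult = monoid.mult (tate_ring n),
      monoid.one = monoid.one (tate_ring n),
      ring.zero = ring.zero (tate_ring n),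
      ring.add = ring.add (tate_ring n),
      module.smult = (\<lambda>a b. (\<phi> \<circ> a) \<otimes>\<^bsub>tate_ring n\<^esub> b)\<rparr>"


section \<open>Tensor products and intersection flatness\<close>

text \<open>
  \<open>L \<otimes>\<^sub>R M\<close> as an abelian group: the free abelian group on \<open>L \<times> M\<close> modulo the subgroup generated
  by the bilinearity and balancing relations.
\<close>

definition tensor_rels ::
  "('r, 'w) ring_scheme \<Rightarrow> ('r, 'l, 'y) module_scheme \<Rightarrow> ('r, 'm, 'z) module_scheme
     \<Rightarrow> ('l \<times> 'm \<Rightarrow>\<^sub>0 int) set" where
  "tensor_rels R L M = generate (free_Abelian_group (carrier L \<times> carrier M))
     ({frag_of (x \<oplus>\<^bsub>L\<^esub> x', m) - frag_of (x, m) - frag_of (x', m) | x x' m.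
         x \<in> carrier L \<and> x' \<in> carrier L \<and> m \<in> carrier M} \<union>
      {frag_of (x, m \<oplus>\<^bsub>M\<^esub> m') - frag_of (x, m) - frag_of (x, m') | x m m'.
         x \<in> carrier L \<and> m \<in> carrier M \<and> m' \<in> carrier M} \<union>
      {frag_of (r \<odot>\<^bsub>L\<^esub> x, m) - frag_of (x, r \<odot>\<^bsub>M\<^esub> m) | r x m.
         r \<in> carrier R \<and> x \<in> carrier L \<and> m \<in> carrier M})"

definition tensor_prod ::
  "('r, 'w) ring_scheme \<Rightarrow> ('r, 'l, 'y) module_scheme \<Rightarrow> ('r, 'm, 'z) module_scheme
     \<Rightarrow> ('l \<times> 'm \<Rightarrow>\<^sub>0 int) set monoid" where
  "tensor_prod R L M = free_Abelian_group (carrier L \<times> carrier M) Mod tensor_rels R L M"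

text \<open>
  The submodule \<open>U M\<close> of \<open>L \<otimes>\<^sub>R M\<close>: the image of \<open>U \<otimes>\<^sub>R M \<rightarrow> L \<otimes>\<^sub>R M\<close>.  On cosets, this map sends
  \<open>N\<^sub>U + c\<close> to \<open>N\<^sub>L + (N\<^sub>U + c) = N\<^sub>L + c\<close>, where \<open>N\<^sub>U \<subseteq> N\<^sub>L\<close> are the respective relation subgroups.
\<close>

definition tensor_image ::
  "('r, 'w) ring_scheme \<Rightarrow> ('r, 'l, 'y) module_scheme \<Rightarrow> 'l set \<Rightarrow> ('r, 'm, 'z) module_scheme
     \<Rightarrow> ('l \<times> 'm \<Rightarrow>\<^sub>0 int) set set" where
  "tensor_image R L U M =
     (\<lambda>X. tensor_rels R L M <#>\<^bsub>free_Abelian_group (carrier L \<times> carrier M)\<^esub> X)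
       ` carrier (tensor_prod R (L\<lparr>carrier := U\<rparr>) M)"

definition finitely_generated_module ::
  "('r, 'w) ring_scheme \<Rightarrow> ('r, 'l, 'y) module_scheme \<Rightarrow> bool" where
  "finitely_generated_module R L \<longleftrightarrow> module R L \<and>
     (\<exists>S. finite S \<and> S \<subseteq> carrier L \<and>
        (\<forall>N. submodule N R L \<and> S \<subseteq> N \<longrightarrow> N = carrier L))"

text \<open>
  The type argument names the type in which the test modules \<open>L\<close> live; a statement about all
  modules leaves it as a type variable.  Intersections are formed inside the ambient module, so
  the intersection of the empty family is everything.
\<close>

definition intersection_flat ::
  "'l itself \<Rightarrow> ('r, 'w) ring_scheme \<Rightarrow> ('r, 'm, 'z) module_scheme \<Rightarrow> bool" where
  "intersection_flat _ R M \<longleftrightarrow> module R M \<and>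
     (\<forall>(L :: ('r, 'l) module) \<U>.
        finitely_generated_module R L \<and> (\<forall>U\<in>\<U>. submodule U R L) \<longrightarrow>
        tensor_image R L (carrier L \<inter> \<Inter>\<U>) M =
          carrier (tensor_prod R L M) \<inter> (\<Inter>U\<in>\<U>. tensor_image R L U M))"

end

theory Submission
  imports Defs "HOL-Library.Function_Algebras"
begin

text \<open>
  Write \<open>R = T\<^sub>n(k)\<close> and \<open>C\<close> for the completed algebraic closure of \<open>k\<close>.
  Every submodule \<open>U\<close> of \<open>R^m\<close> has a finite standard basis with respect to leading exponents (Dickson's
  lemma), and vectors over \<open>T\<^sub>n(C)\<close> can be divided by it, with remainder supported off the leading
  exponents of \<open>U\<close>.  A bounded \<open>k\<close>-linear functional \<open>\<psi>\<close> on a subspace of \<open>C\<close> that contains the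
  coefficients involved maps \<open>U T\<^sub>n(C)\<close> into \<open>U\<close>, and such functionals extend over countably many further
  elements of \<open>C\<close>.  Now let \<open>y\<close> lie in \<open>U\<^sub>i T\<^sub>n(C)\<close> for all \<open>i\<close> and divide \<open>y\<close> by the intersection \<open>W\<close> of
  the \<open>U\<^sub>i\<close>.  If the remainder \<open>r\<close> had a nonzero coefficient, choose \<open>\<psi>\<close> not vanishing on it: then
  \<open>\<psi> \<circ> y\<close> lies in all \<open>U\<^sub>i\<close>, so \<open>\<psi> \<circ> r\<close> is a nonzero element of \<open>W\<close> supported off the leading
  exponents of \<open>W\<close>, which is absurd.  Presenting a finitely generated module as a quotient of
  \<open>R^m\<close> transfers this to tensor products.
\<close>

section \<open>Non-Archimedean absolute values\<close>

text \<open>The obstacle is the supply of functionals. Hahn-Banach can fail over a field that is not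
  spherically complete, so a functional on the line through one coefficient cannot be expected to
  extend to all of \<open>C\<close>. Adding one point, however, costs an arbitrarily small increase
  of the bound, so countably many points cost at most a factor 2, and a series has only countably
  many coefficients. The family of the \<open>U\<^sub>i\<close> may be uncountable, so one countable
  domain need not suffice for presentations of \<open>y\<close> over all of them. The functional is
  therefore first fixed on the coefficients of \<open>r\<close> and of the quotients, hence on those
  of \<open>y\<close>, and then extended anew for each \<open>U\<^sub>i\<close>; this does not
  change its values on \<open>y\<close>. Division converges because reduction by a standard basis
  works modulo a factor \<epsilon> < 1. This factor is uniform because the basis is finite and each
  of its series attains only finitely many absolute values above a positive threshold.\<close>

lemma na_abs_0 [simp]: "na_abs (0::'a::na_valued_field) = 0"
  by (simp add: na_abs_eq_0_iff)

lemma na_abs_nonneg [simp]: "na_abs (x::'a::na_valued_field) \<ge> 0"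
  using zero_le_dist[of x 0] by (simp add: dist_na_abs)

lemma na_abs_pos_iff [simp]: "0 < na_abs (x::'a::na_valued_field) \<longleftrightarrow> x \<noteq> 0"
  by (metis na_abs_eq_0_iff na_abs_nonneg less_le)

lemma na_abs_1 [simp]: "na_abs (1::'a::na_valued_field) = 1"
  using na_abs_mult[of "1::'a" 1] na_abs_eq_0_iff[of "1::'a"] by simp

lemma na_abs_minus [simp]: "na_abs (- x::'a::na_valued_field) = na_abs x"
proof -
  have "na_abs (-1::'a) * na_abs (-1::'a) = 1"
    by (simp flip: na_abs_mult)
  then have "na_abs (-1::'a) = 1"
    by (metis na_abs_nonneg power2_eq_square power2_eq_1_iff neg_0_le_iff_le not_one_le_zero)
  then show ?thesis using na_abs_mult[of "-1" x] by simp
qed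

lemma na_abs_diff_le: "na_abs (x - y::'a::na_valued_field) \<le> max (na_abs x) (na_abs y)"
  using na_abs_add_le[of x "-y"] by simp

lemma na_abs_add_bound:
  "na_abs x \<le> B \<Longrightarrow> na_abs y \<le> B \<Longrightarrow> na_abs (x + y::'a::na_valued_field) \<le> B"
  using na_abs_add_le[of x y] by simp

lemma na_abs_diff_bound:
  "na_abs x \<le> B \<Longrightarrow> na_abs y \<le> B \<Longrightarrow> na_abs (x - y::'a::na_valued_field) \<le> B"
  using na_abs_diff_le[of x y] by simp

lemma na_abs_sum_bound:
  fixes f :: "'b \<Rightarrow> 'a::na_valued_field"
  assumes "0 \<le> B" "\<And>i. i \<in> A \<Longrightarrow> na_abs (f i) \<le> B"
  shows "na_abs (sum f A) \<le> B"
  using assms(2)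
  by (induction A rule: infinite_finite_induct) (auto simp: assms(1) intro!: na_abs_add_bound)

text \<open>Ultrametric telescoping: a geometric bound on consecutive differences is inherited by the
  distance to the limit without summing the series.\<close>

lemma na_geometric_limit:
  fixes x :: "nat \<Rightarrow> 'a::{na_valued_field, complete_space}"
  assumes eps: "0 \<le> \<epsilon>" "\<epsilon> < 1" and A: "0 \<le> A"
    and step: "\<And>j. na_abs (x (Suc j) - x j) \<le> A * \<epsilon> ^ j"
  shows "\<exists>l. \<forall>j. na_abs (l - x j) \<le> A * \<epsilon> ^ j"
proof -
  have tail: "na_abs (x (j + i) - x j) \<le> A * \<epsilon> ^ j" for i j
  proof (induction i)
    case (Suc i)
    have "A * \<epsilon> ^ (j + i) \<le> A * \<epsilon> ^ j"
      using eps A by (intro mult_left_mono power_decreasing) auto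
    then have "na_abs ((x (Suc (j + i)) - x (j + i)) + (x (j + i) - x j)) \<le> A * \<epsilon> ^ j"
      using step[of "j + i"] Suc by (intro na_abs_add_bound) auto
    then show ?case by simp
  qed (use eps A in simp)
  have lim: "(\<lambda>j. A * \<epsilon> ^ j) \<longlonglongrightarrow> 0"
    using eps by (intro tendsto_mult_right_zero LIMSEQ_power_zero) auto
  have "Cauchy x"
  proof (rule metric_CauchyI)
    fix e :: real assume "0 < e"
    then obtain N where N: "A * \<epsilon> ^ N < e"
      using lim by (metis (no_types, lifting) eventually_sequentially order_tendstoD(2) order_refl)
    have "dist (x m) (x n) < e" if "m \<ge> N" "n \<ge> N" for m n
    proof -
      have "na_abs (x m - x N) \<le> A * \<epsilon> ^ N" "na_abs (x n - x N) \<le> A * \<epsilon> ^ N"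
        using tail[of N "m - N"] tail[of N "n - N"] that by auto
      then have "na_abs ((x m - x N) - (x n - x N)) \<le> A * \<epsilon> ^ N"
        by (rule na_abs_diff_bound)
      then show ?thesis using N by (simp add: dist_na_abs)
    qed
    then show "\<exists>N. \<forall>m\<ge>N. \<forall>n\<ge>N. dist (x m) (x n) < e" by blast
  qed
  then obtain l where l: "x \<longlonglongrightarrow> l"
    using Cauchy_convergent convergent_def by blast
  have "na_abs (l - x j) \<le> A * \<epsilon> ^ j" for j
  proof -
    have "(\<lambda>i. dist (x (i + j)) (x j)) \<longlonglongrightarrow> dist l (x j)"
      using LIMSEQ_ignore_initial_segment[OF l, of j] by (intro tendsto_dist tendsto_const)
    moreover have "dist (x (i + j)) (x j) \<le> A * \<epsilon> ^ j" for i
      using tail[of j i] by (simp add: dist_na_abs add.commute)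
    ultimately have "dist l (x j) \<le> A * \<epsilon> ^ j"
      by (intro LIMSEQ_le_const2) auto
    then show ?thesis by (simp add: dist_na_abs)
  qed
  then show ?thesis by blast
qed


section \<open>Products of power series\<close>

text \<open>A summand \<alpha> of \<nu> is bounded by \<nu> in every coordinate, and cancellation
  recovers \<beta> from \<alpha>; so the decompositions inject into a finite set of
  functions.\<close>

lemma finite_decompositions:
  "finite {(\<alpha>, \<beta>). \<alpha> + \<beta> = (\<nu> :: nat \<Rightarrow>\<^sub>0 nat)}"
proof -
  let ?F = "{f. \<forall>x. (x \<in> Poly_Mapping.keys \<nu> \<longrightarrow> f x \<in> {..Max (range (Poly_Mapping.lookup \<nu>))})
    \<and> (x \<notin> Poly_Mapping.keys \<nu> \<longrightarrow> f x = 0)}"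
  have "finite (range (Poly_Mapping.lookup \<nu>))"
    by (rule finite_subset[of _ "insert 0 (Poly_Mapping.lookup \<nu> ` Poly_Mapping.keys \<nu>)"])
      (auto simp: in_keys_iff)
  then have Max: "Poly_Mapping.lookup \<nu> i \<le> Max (range (Poly_Mapping.lookup \<nu>))" for i
    by simp
  have fin: "finite ?F"
    by (rule finite_set_of_finite_funs) auto
  have "Poly_Mapping.lookup \<alpha> \<in> ?F" if "\<alpha> + \<beta> = \<nu>" for \<alpha> \<beta>
  proof -
    have "Poly_Mapping.lookup \<alpha> i \<le> Poly_Mapping.lookup \<nu> i" for i
      using that by (auto simp: lookup_add)
    then have "Poly_Mapping.lookup \<alpha> i \<le> Max (range (Poly_Mapping.lookup \<nu>))"
      and "i \<notin> Poly_Mapping.keys \<nu> \<Longrightarrow> Poly_Mapping.lookup \<alpha> i = 0" for i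
      using Max[of i] le_trans by (blast, metis in_keys_iff le_zero_eq)
    then show ?thesis by simp
  qed
  then have "(\<lambda>p. Poly_Mapping.lookup (fst p)) ` {(\<alpha>, \<beta>). \<alpha> + \<beta> = \<nu>} \<subseteq> ?F"
    by auto
  moreover have "inj_on (\<lambda>p. Poly_Mapping.lookup (fst p)) {(\<alpha>, \<beta>). \<alpha> + \<beta> = \<nu>}"
    by (auto simp: inj_on_def)
  ultimately show ?thesis
    using fin finite_imageD finite_subset by blast
qed

text \<open>The product of \<open>power_series_ring\<close>, which does not depend on the number of
  variables. Outside the record it also multiplies a series in n variables with a tuple encoded in n
  + 1 variables.\<close>

definition conv :: "'k::field mseries \<Rightarrow> 'k mseries \<Rightarrow> 'k mseries" (infixl "\<star>" 70) where
  "a \<star> b = (\<lambda>\<nu>. \<Sum>(\<alpha>, \<beta>) | \<alpha> + \<beta> = \<nu>. a \<alpha> * b \<beta>)"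

definition monomial :: "'k::field \<Rightarrow> (nat \<Rightarrow>\<^sub>0 nat) \<Rightarrow> 'k mseries" where
  "monomial c \<mu> = (\<lambda>\<nu>. if \<nu> = \<mu> then c else 0)"

lemma conv_commute: "a \<star> b = b \<star> a"
  unfolding conv_def fun_eq_iff
  by (intro allI sum.reindex_bij_witness[of _ prod.swap prod.swap]) (auto simp: ac_simps)

text \<open>Both sides are sums over the ways of writing \<nu> as three summands; the reindexing
  only moves the bracket.\<close>

lemma conv_assoc: "(a \<star> b) \<star> c = a \<star> (b \<star> c)"
proof
  fix \<nu>
  note fin = finite_decompositions
  have "((a \<star> b) \<star> c) \<nu> =
      (\<Sum>p | fst p + snd p = \<nu>. \<Sum>q | fst q + snd q = fst p. a (fst q) * b (snd q) * c (snd p))"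
    by (simp add: conv_def case_prod_unfold sum_distrib_right)
  also have "\<dots> = (\<Sum>(p, q) \<in> (SIGMA p:{p. fst p + snd p = \<nu>}. {q. fst q + snd q = fst p}).
      a (fst q) * b (snd q) * c (snd p))"
    using fin by (subst sum.Sigma) (auto simp: case_prod_unfold)
  also have "\<dots> = (\<Sum>(p, q) \<in> (SIGMA p:{p. fst p + snd p = \<nu>}. {q. fst q + snd q = snd p}).
      a (fst p) * (b (fst q) * c (snd q)))"
    by (rule sum.reindex_bij_witness
        [of _ "\<lambda>(p, q). ((fst p + fst q, snd q), (fst p, fst q))"
              "\<lambda>(p, q). ((fst q, snd q + snd p), (snd q, snd p))"]) (auto simp: ac_simps)
  also have "\<dots> = (\<Sum>p | fst p + snd p = \<nu>. \<Sum>q | fst q + snd q = snd p. a (fst p) * (b (fst q) * c (snd q)))"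
    using fin by (subst sum.Sigma) (auto simp: case_prod_unfold)
  also have "\<dots> = (a \<star> (b \<star> c)) \<nu>"
    by (simp add: conv_def case_prod_unfold sum_distrib_left)
  finally show "((a \<star> b) \<star> c) \<nu> = (a \<star> (b \<star> c)) \<nu>" .
qed

lemma conv_left_commute: "a \<star> (b \<star> c) = b \<star> (a \<star> c)"
  by (metis conv_assoc conv_commute)

lemma conv_add_right: "a \<star> (b + c) = a \<star> b + a \<star> c"
  by (simp add: conv_def fun_eq_iff case_prod_unfold distrib_left sum.distrib)

lemma conv_add_left: "(a + b) \<star> c = a \<star> c + b \<star> c"
  by (metis conv_add_right conv_commute)

lemma conv_zero [simp]: "a \<star> 0 = 0" "0 \<star> a = 0"
  by (simp_all add: conv_def fun_eq_iff)

lemma conv_minus_right: "a \<star> (- b) = - (a \<star> b)"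
  by (simp add: conv_def fun_eq_iff case_prod_unfold sum_negf)

lemma conv_minus_left: "(- a) \<star> b = - (a \<star> b)"
  by (metis conv_minus_right conv_commute)

lemma conv_diff_right: "a \<star> (b - c) = a \<star> b - a \<star> c"
  using conv_add_right[of a b "- c"] by (simp add: conv_minus_right)

lemma conv_eq_0:
  assumes "\<And>\<alpha> \<beta>. \<alpha> + \<beta> = \<nu> \<Longrightarrow> a \<alpha> = 0 \<or> b \<beta> = 0"
  shows "(a \<star> b) \<nu> = 0"
  unfolding conv_def using assms by (intro sum.neutral) auto

lemma monomial_conv_add [simp]: "(monomial c \<mu> \<star> f) (\<mu> + \<beta>) = c * f \<beta>"
proof -
  have "(monomial c \<mu> \<star> f) (\<mu> + \<beta>) = (\<Sum>p \<in> {(\<mu>, \<beta>)}. monomial c \<mu> (fst p) * f (snd p))"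
    unfolding conv_def
    by (intro sum.mono_neutral_cong_right finite_decompositions)
      (auto simp: monomial_def split: if_splits)
  then show ?thesis by (simp add: monomial_def)
qed

lemma monomial_conv_eq_0: "(\<And>\<beta>. \<nu> \<noteq> \<mu> + \<beta>) \<Longrightarrow> (monomial c \<mu> \<star> f) \<nu> = 0"
  by (rule conv_eq_0) (auto simp: monomial_def)

lemma monomial_0_conv: "(monomial c 0 \<star> f) \<nu> = c * f \<nu>"
  using monomial_conv_add[of c 0 f \<nu>] by simp

lemma one_conv [simp]: "monomial 1 0 \<star> f = f"
  by (simp add: fun_eq_iff monomial_0_conv)


section \<open>Null series\<close>

text \<open>Convergence to zero along the cofinite filter. For X = \<open>exps n\<close> this gives
  the Tate algebra (\<open>carrier_tate_ring\<close>), for X = \<open>vexps n m\<close> the free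
  module of rank m over it.\<close>

definition null_series :: "(nat \<Rightarrow>\<^sub>0 nat) set \<Rightarrow> 'k::na_valued_field mseries set" where
  "null_series X = {a. (\<forall>\<nu>. \<nu> \<notin> X \<longrightarrow> a \<nu> = 0) \<and> (\<forall>e>0. finite {\<nu>. e \<le> na_abs (a \<nu>)})}"

lemma null_seriesD:
  assumes "a \<in> null_series X"
  shows "\<nu> \<notin> X \<Longrightarrow> a \<nu> = 0" "e > 0 \<Longrightarrow> finite {\<nu>. e \<le> na_abs (a \<nu>)}"
  using assms by (auto simp: null_series_def)

lemma null_series_zero [simp]: "0 \<in> null_series X"
  by (auto simp: null_series_def)

lemma null_series_monomial: "\<mu> \<in> X \<Longrightarrow> monomial c \<mu> \<in> null_series X"
proof -
  have "{\<nu>. e \<le> na_abs (monomial c \<mu> \<nu>)} \<subseteq> {\<mu>}" if "e > 0" for e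
    using that by (auto simp: monomial_def split: if_splits)
  then show "\<mu> \<in> X \<Longrightarrow> monomial c \<mu> \<in> null_series X"
    by (auto simp: null_series_def monomial_def dest: finite_subset)
qed

lemma null_series_add:
  assumes "a \<in> null_series X" "b \<in> null_series X"
  shows "a + b \<in> null_series X"
proof -
  have "{\<nu>. e \<le> na_abs (a \<nu> + b \<nu>)} \<subseteq> {\<nu>. e \<le> na_abs (a \<nu>)} \<union> {\<nu>. e \<le> na_abs (b \<nu>)}" for e
    using na_abs_add_le order_trans by (blast dest: le_max_iff_disj[THEN iffD1])
  then have "finite {\<nu>. e \<le> na_abs (a \<nu> + b \<nu>)}" if "e > 0" for e
    using assms null_seriesD(2) that by (metis finite_UnI finite_subset)
  then show ?thesis
    using assms by (auto simp: null_series_def)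
qed

lemma null_series_uminus: "a \<in> null_series X \<Longrightarrow> - a \<in> null_series X"
  by (auto simp: null_series_def)

lemma null_series_diff: "a \<in> null_series X \<Longrightarrow> b \<in> null_series X \<Longrightarrow> a - b \<in> null_series X"
  using null_series_add[of a X "- b"] null_series_uminus[of b X] by simp

lemma null_series_sum: "(\<And>i. i \<in> I \<Longrightarrow> f i \<in> null_series X) \<Longrightarrow> sum f I \<in> null_series X"
  by (induction I rule: infinite_finite_induct) (auto intro: null_series_add)

lemma null_series_bounded:
  assumes "a \<in> null_series X"
  obtains A where "A > 0" "\<And>\<nu>. na_abs (a \<nu>) \<le> A"
proof
  let ?F = "{\<nu>. 1 \<le> na_abs (a \<nu>)}"
  have fin: "finite ?F" using null_seriesD(2)[OF assms, of 1] by simp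
  show "(1::real) + (\<Sum>\<nu>\<in>?F. na_abs (a \<nu>)) > 0" by (simp add: add_pos_nonneg sum_nonneg)
  show "na_abs (a \<nu>) \<le> 1 + (\<Sum>\<nu>\<in>?F. na_abs (a \<nu>))" for \<nu>
  proof (cases "\<nu> \<in> ?F")
    case True
    then show ?thesis using member_le_sum[of \<nu> ?F "\<lambda>\<nu>. na_abs (a \<nu>)"] fin by simp
  next
    case False
    then show ?thesis using sum_nonneg[of ?F "\<lambda>\<nu>. na_abs (a \<nu>)"] by simp
  qed
qed

lemma conv_bound:
  assumes "0 \<le> B" "\<And>\<alpha> \<beta>. na_abs (a \<alpha> * b \<beta>) \<le> B"
  shows "na_abs ((a \<star> b) \<nu>) \<le> B"
  unfolding conv_def using assms by (intro na_abs_sum_bound) auto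

text \<open>A large coefficient of the product contains a large term; as both series are bounded,
  both factors of that term are large, which leaves finitely many pairs of exponents.\<close>

lemma null_series_conv:
  assumes a: "a \<in> null_series X" and b: "b \<in> null_series Y"
    and XY: "\<And>\<alpha> \<beta>. \<alpha> \<in> X \<Longrightarrow> \<beta> \<in> Y \<Longrightarrow> \<alpha> + \<beta> \<in> Z"
  shows "a \<star> b \<in> null_series Z"
proof -
  obtain A where A: "A > 0" "\<And>\<nu>. na_abs (a \<nu>) \<le> A" using null_series_bounded[OF a] by metis
  obtain B where B: "B > 0" "\<And>\<nu>. na_abs (b \<nu>) \<le> B" using null_series_bounded[OF b] by metis
  have "(a \<star> b) \<nu> = 0" if "\<nu> \<notin> Z" for \<nu>
    using that XY null_seriesD(1)[OF a] null_seriesD(1)[OF b] by (intro conv_eq_0) metis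
  moreover have "finite {\<nu>. e \<le> na_abs ((a \<star> b) \<nu>)}" if e: "e > 0" for e
  proof -
    \<comment> \<open>The factor 2 leaves a gap: without a large pair, the coefficient is at most e
      / 2 < e.\<close>
    let ?FA = "{\<nu>. e / (2*B) \<le> na_abs (a \<nu>)}" and ?FB = "{\<nu>. e / (2*A) \<le> na_abs (b \<nu>)}"
    have "\<nu> \<in> (\<lambda>(\<alpha>, \<beta>). \<alpha> + \<beta>) ` (?FA \<times> ?FB)" if \<nu>: "e \<le> na_abs ((a \<star> b) \<nu>)" for \<nu>
    proof (rule ccontr)
      assume n: "\<nu> \<notin> (\<lambda>(\<alpha>, \<beta>). \<alpha> + \<beta>) ` (?FA \<times> ?FB)"
      have "na_abs (a \<alpha> * b \<beta>) \<le> e / 2" if "\<alpha> + \<beta> = \<nu>" for \<alpha> \<beta>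
      proof -
        consider "na_abs (a \<alpha>) \<le> e / (2*B)" | "na_abs (b \<beta>) \<le> e / (2*A)"
          using n \<open>\<alpha> + \<beta> = \<nu>\<close> by force
        then show ?thesis
        proof cases
          case 1
          then have "na_abs (a \<alpha>) * na_abs (b \<beta>) \<le> e / (2*B) * B"
            using B e by (intro mult_mono) auto
          then show ?thesis using B by (simp add: na_abs_mult)
        next
          case 2
          then have "na_abs (a \<alpha>) * na_abs (b \<beta>) \<le> A * (e / (2*A))"
            using A e by (intro mult_mono) auto
          then show ?thesis using A by (simp add: na_abs_mult)
        qed
      qed
      then have "na_abs ((a \<star> b) \<nu>) \<le> e / 2"
        unfolding conv_def using e by (intro na_abs_sum_bound) auto
      then show False using \<nu> e by simp
    qed
    moreover have "finite (?FA \<times> ?FB)"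
      using null_seriesD(2)[OF a] null_seriesD(2)[OF b] A B e by simp
    moreover have "{\<nu>. e \<le> na_abs ((a \<star> b) \<nu>)} \<subseteq> (\<lambda>(\<alpha>, \<beta>). \<alpha> + \<beta>) ` (?FA \<times> ?FB)"
      using calculation(1) by blast
    ultimately show ?thesis using finite_surj by blast
  qed
  ultimately show ?thesis by (simp add: null_series_def)
qed

lemma null_series_compose:
  assumes "a \<in> null_series X" "h 0 = 0" "\<And>\<nu>. na_abs (h (a \<nu>)) \<le> B * na_abs (a \<nu>)"
  shows "h \<circ> a \<in> null_series X"
proof -
  have "finite {\<nu>. e \<le> na_abs (h (a \<nu>))}" if "e > 0" for e
  proof -
    \<comment> \<open>B may be zero or negative, so the threshold is divided by the positive bound
      \<bar>B\<bar> + 1.\<close>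
    have "e / (\<bar>B\<bar> + 1) \<le> na_abs (a \<nu>)" if "e \<le> na_abs (h (a \<nu>))" for \<nu>
    proof -
      have "e \<le> B * na_abs (a \<nu>)" using that assms(3) order_trans by blast
      also have "\<dots> \<le> (\<bar>B\<bar> + 1) * na_abs (a \<nu>)" by (intro mult_right_mono) auto
      finally show ?thesis by (simp add: field_simps)
    qed
    moreover have "e / (\<bar>B\<bar> + 1) > 0" using that by simp
    ultimately have "{\<nu>. e \<le> na_abs (h (a \<nu>))} \<subseteq> {\<nu>. e / (\<bar>B\<bar> + 1) \<le> na_abs (a \<nu>)}"
      and "finite {\<nu>. e / (\<bar>B\<bar> + 1) \<le> na_abs (a \<nu>)}"
      using null_seriesD(2)[OF assms(1)] by auto
    then show ?thesis by (rule finite_subset)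
  qed
  then show ?thesis using assms by (auto simp: null_series_def)
qed

text \<open>Nonzero coefficients exceed some 1 / (j + 1), and each such threshold is passed only
  finitely often. Countability puts the coefficients of a series within reach of functionals that
  are extended one point at a time.\<close>

lemma countable_null_series_range:
  assumes "a \<in> null_series X"
  shows "countable (range a)"
proof -
  have "{\<nu>. a \<nu> \<noteq> 0} \<subseteq> (\<Union>j. {\<nu>. inverse (real (Suc j)) \<le> na_abs (a \<nu>)})"
  proof
    fix \<nu> assume "\<nu> \<in> {\<nu>. a \<nu> \<noteq> 0}"
    then obtain j where "inverse (real (Suc j)) < na_abs (a \<nu>)"
      using reals_Archimedean[of "na_abs (a \<nu>)"] by auto
    then show "\<nu> \<in> (\<Union>j. {\<nu>. inverse (real (Suc j)) \<le> na_abs (a \<nu>)})"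
      using less_imp_le by blast
  qed
  moreover have "countable (\<Union>j. {\<nu>. inverse (real (Suc j)) \<le> na_abs (a \<nu>)})"
    by (intro countable_UN countableI_type countable_finite null_seriesD(2)[OF assms]) auto
  ultimately have "countable {\<nu>. a \<nu> \<noteq> 0}"
    using countable_subset by blast
  moreover have "range a \<subseteq> insert 0 (a ` {\<nu>. a \<nu> \<noteq> 0})" by auto
  ultimately show ?thesis by (meson countable_image countable_insert countable_subset)
qed


section \<open>Exponents\<close>

definition exps :: "nat \<Rightarrow> (nat \<Rightarrow>\<^sub>0 nat) set" where
  "exps n = {\<nu>. Poly_Mapping.keys \<nu> \<subseteq> {..<n}}"

text \<open>An \<open>m\<close>-tuple of series in \<open>n\<close> variables is encoded as one series in \<open>n + 1\<close> variables, in
  which the exponent of the additional variable is the position in the tuple.  Scalar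
  multiplication on tuples is then multiplication of series.\<close>

definition vexps :: "nat \<Rightarrow> nat \<Rightarrow> (nat \<Rightarrow>\<^sub>0 nat) set" where
  "vexps n m = {\<nu> \<in> exps (Suc n). Poly_Mapping.lookup \<nu> n < m}"

lemma lookup_exps_0: "\<nu> \<in> exps n \<Longrightarrow> n \<le> i \<Longrightarrow> Poly_Mapping.lookup \<nu> i = 0"
  unfolding exps_def by (metis in_keys_iff lessThan_iff linorder_not_less mem_Collect_eq subsetD)

lemma expsI: "(\<And>i. n \<le> i \<Longrightarrow> Poly_Mapping.lookup \<nu> i = 0) \<Longrightarrow> \<nu> \<in> exps n"
  by (auto simp: exps_def in_keys_iff) (metis not_le not_less_zero)

lemma zero_in_exps [simp]: "0 \<in> exps n"
  by (simp add: exps_def)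

lemma exps_add: "\<mu> \<in> exps n \<Longrightarrow> \<nu> \<in> exps n \<Longrightarrow> \<mu> + \<nu> \<in> exps n"
  by (rule expsI) (simp add: lookup_add lookup_exps_0)

lemma vexps_add: "\<mu> \<in> exps n \<Longrightarrow> \<nu> \<in> vexps n m \<Longrightarrow> \<mu> + \<nu> \<in> vexps n m"
  by (auto simp: vexps_def lookup_add lookup_exps_0 intro!: expsI)

lemma zero_le_exponent: "0 \<le> (\<mu> :: nat \<Rightarrow>\<^sub>0 nat)"
  by (rule leI) (auto simp: less_poly_mapping.rep_eq less_fun_def)

text \<open>Exponents are compared at the first coordinate where they differ, so in n variables the
  order is the lexicographic one on lists of length n. With unboundedly many variables it is not
  well-founded: the unit exponents of the variables 0, 1, 2, ... descend forever.\<close>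

lemma wf_exps: "wf {(\<mu>, \<nu>). \<mu> \<in> exps n \<and> \<nu> \<in> exps n \<and> \<mu> < \<nu>}"
proof (rule wf_subset[OF wf_inv_image[OF wf_lexn[OF wf_less_than]]], safe)
  fix \<mu> \<nu> assume \<mu>: "\<mu> \<in> exps n" and \<nu>: "\<nu> \<in> exps n" and "\<mu> < \<nu>"
  then obtain k where k: "Poly_Mapping.lookup \<mu> k < Poly_Mapping.lookup \<nu> k"
    and eq: "\<And>i. i < k \<Longrightarrow> Poly_Mapping.lookup \<mu> i = Poly_Mapping.lookup \<nu> i"
    by (auto simp: less_poly_mapping.rep_eq less_fun_def)
  have "k < n" using k lookup_exps_0[OF \<nu>] by (metis not_le not_less_zero)
  then have split: "[0..<n] = [0..<k] @ k # [Suc k..<n]"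
    by (metis less_imp_le_nat upt_add_eq_append upt_conv_Cons le_add_diff_inverse zero_le)
  show "(\<mu>, \<nu>) \<in> inv_image (lexn less_than n) (\<lambda>\<nu>. map (Poly_Mapping.lookup \<nu>) [0..<n])"
    unfolding in_inv_image lexn_conv
  proof (safe, goal_cases)
    case 3
    show ?case
      using k eq unfolding split
      by (intro exI[of _ "map (Poly_Mapping.lookup \<nu>) [0..<k]"]) auto
  qed auto
qed

lemma exps_induct [consumes 1, case_names less]:
  assumes "\<nu> \<in> exps n" "\<And>\<nu>. \<nu> \<in> exps n \<Longrightarrow> (\<And>\<mu>. \<mu> \<in> exps n \<Longrightarrow> \<mu> < \<nu> \<Longrightarrow> P \<mu>) \<Longrightarrow> P \<nu>"
  shows "P \<nu>"
  using wf_exps[of n] assms(1)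
proof (induction \<nu> rule: wf_induct_rule)
  case (less \<nu>)
  then show ?case using assms(2) by blast
qed

lemma nat_incseq_subseq:
  fixes f :: "nat \<Rightarrow> nat"
  shows "\<exists>s. strict_mono s \<and> incseq (f \<circ> s)"
proof -
  obtain s where s: "strict_mono s" "monoseq (\<lambda>j. f (s j))"
    using seq_monosub by metis
  then consider "incseq (f \<circ> s)" | "decseq (f \<circ> s)"
    by (auto simp: monoseq_iff comp_def)
  then show ?thesis
  proof cases
    case 2
    \<comment> \<open>A decreasing sequence of naturals is constant from the index of its minimal
      value on.\<close>
    define J where "J = (ARG_MIN (f \<circ> s) j. True)"
    have J: "(f \<circ> s) J \<le> (f \<circ> s) j" for j
      unfolding J_def by (rule arg_min_nat_le) simp
    have "(f \<circ> s) (J + j) = (f \<circ> s) J" for j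
      using J[of "J + j"] decseqD[OF 2, of J "J + j"] by simp
    then have "incseq (f \<circ> (\<lambda>j. s (J + j)))"
      by (simp add: incseq_def)
    moreover have "strict_mono (\<lambda>j. s (J + j))"
      using s(1) by (simp add: strict_mono_def)
    ultimately show ?thesis by blast
  qed (use s in blast)
qed

lemma exists_componentwise_incseq:
  fixes x :: "nat \<Rightarrow> (nat \<Rightarrow>\<^sub>0 nat)"
  shows "\<exists>s. strict_mono s \<and> (\<forall>i<n. incseq (\<lambda>j. Poly_Mapping.lookup (x (s j)) i))"
proof (induction n)
  case 0
  show ?case using strict_mono_id by auto
next
  case (Suc n)
  then obtain s where s: "strict_mono s" "\<forall>i<n. incseq (\<lambda>j. Poly_Mapping.lookup (x (s j)) i)"
    by blast
  obtain t where t: "strict_mono t" "incseq ((\<lambda>j. Poly_Mapping.lookup (x (s j)) n) \<circ> t)"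
    using nat_incseq_subseq by blast
  have "incseq (\<lambda>j. Poly_Mapping.lookup (x ((s \<circ> t) j)) i)" if "i < Suc n" for i
  proof (cases "i = n")
    case True
    then show ?thesis using t(2) by (simp add: comp_def)
  next
    case False
    then have "incseq (\<lambda>j. Poly_Mapping.lookup (x (s j)) i)" using s(2) that by simp
    then show ?thesis
      using strict_mono_mono[OF t(1)] by (simp add: incseq_def mono_def)
  qed
  then show ?case using strict_mono_o[OF s(1) t(1)] by blast
qed

text \<open>B consists of the elements of X that are not proper translates of others, and descent
  along the exponent order leads from any p to B. An infinite B would contain a coordinatewise
  increasing sequence, in which one element is a translate of another, against minimality.\<close>

lemma dickson:
  assumes X: "X \<subseteq> vexps n m"
  shows "\<exists>B. finite B \<and> B \<subseteq> X \<and> (\<forall>p\<in>X. \<exists>b\<in>B. \<exists>\<mu>\<in>exps n. p = \<mu> + b)"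
proof -
  define B where "B = {p \<in> X. \<forall>b\<in>X. \<forall>\<mu>\<in>exps n. p = \<mu> + b \<longrightarrow> b = p}"
  have "\<exists>b\<in>B. \<exists>\<mu>\<in>exps n. p = \<mu> + b" if "p \<in> exps (Suc n)" "p \<in> X" for p
    using that
  proof (induction p rule: exps_induct)
    case (less p)
    show ?case
    proof (cases "p \<in> B")
      case True
      moreover have "p = 0 + p" by simp
      ultimately show ?thesis using zero_in_exps by blast
    next
      case False
      then obtain b \<mu> where b: "b \<in> X" "\<mu> \<in> exps n" "p = \<mu> + b" "b \<noteq> p"
        using less.prems by (auto simp: B_def)
      then have "\<mu> \<noteq> 0" by auto
      then have "0 < \<mu>" using zero_le_exponent[of \<mu>] by (simp add: less_le)
      then have "b < p" using b(3) add_strict_right_mono[of 0 \<mu> b] by simp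
      moreover have "b \<in> exps (Suc n)" using b(1) X by (auto simp: vexps_def)
      ultimately obtain b' \<mu>' where b': "b' \<in> B" "\<mu>' \<in> exps n" "b = \<mu>' + b'"
        using less.IH b(1) by blast
      then have "p = (\<mu> + \<mu>') + b'" using b(3) by (simp add: add.assoc)
      then show ?thesis using b' exps_add[OF b(2) b'(2)] by blast
    qed
  qed
  moreover have "finite B"
  proof (rule ccontr)
    assume "infinite B"
    \<comment> \<open>Translation by \<open>exps n\<close> fixes the last coordinate, the position
      in the tuple, so the elements to be compared must first be made to agree there.\<close>
    moreover have "(\<lambda>p. Poly_Mapping.lookup p n) ` B \<subseteq> {..<m}"
      using X by (auto simp: B_def vexps_def)
    ultimately obtain p0 where "p0 \<in> B"
      and inf: "infinite {p \<in> B. Poly_Mapping.lookup p n = Poly_Mapping.lookup p0 n}"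
      using pigeonhole_infinite[of B "\<lambda>p. Poly_Mapping.lookup p n"] finite_subset by blast
    obtain x :: "nat \<Rightarrow> nat \<Rightarrow>\<^sub>0 nat" where x: "inj x"
      "range x \<subseteq> {p \<in> B. Poly_Mapping.lookup p n = Poly_Mapping.lookup p0 n}"
      using infinite_countable_subset[OF inf] by blast
    obtain s where s: "strict_mono s" "\<forall>i<n. incseq (\<lambda>j. Poly_Mapping.lookup (x (s j)) i)"
      using exists_componentwise_incseq by blast
    let ?p = "x (s 0)" and ?q = "x (s 1)"
    have xB: "x j \<in> B" "Poly_Mapping.lookup (x j) n = Poly_Mapping.lookup p0 n" for j
      using x(2) by blast+
    then have B: "?p \<in> B" "?q \<in> B" and pq: "Poly_Mapping.lookup ?p n = Poly_Mapping.lookup ?q n"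
      by simp_all
    have exps: "?p \<in> exps (Suc n)" "?q \<in> exps (Suc n)"
      using B X by (auto simp: B_def vexps_def)
    have le: "Poly_Mapping.lookup ?p i \<le> Poly_Mapping.lookup ?q i" for i
    proof -
      consider "i < n" | "i = n" | "Suc n \<le> i" by linarith
      then show ?thesis
      proof cases
        case 1
        then show ?thesis using s(2) by (auto simp: incseq_def)
      next
        case 3
        then show ?thesis using lookup_exps_0 exps by simp
      qed (simp add: pq)
    qed
    have "?q = (?q - ?p) + ?p"
      using le by (intro poly_mapping_eqI) (simp add: lookup_add lookup_minus)
    moreover have "?q - ?p \<in> exps n"
    proof (rule expsI)
      fix i assume "n \<le> i"
      then show "Poly_Mapping.lookup (?q - ?p) i = 0"
        using lookup_exps_0[OF exps(1), of i] lookup_exps_0[OF exps(2), of i] pq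
        by (cases "i = n") (auto simp: lookup_minus)
    qed
    moreover have "?p \<in> X" "\<forall>b\<in>X. \<forall>\<mu>\<in>exps n. ?q = \<mu> + b \<longrightarrow> b = ?q"
      using B unfolding B_def by blast+
    ultimately have "?p = ?q" by blast
    then have "s 0 = s 1" using x(1) by (simp add: inj_eq)
    then show False using s(1) by (metis strict_mono_eq zero_neq_one)
  qed
  ultimately show ?thesis
    using X unfolding B_def vexps_def by blast
qed


section \<open>Leading exponents\<close>

text \<open>In a nonzero null series the maximal absolute value is attained at finitely many
  exponents, and the leading one is the largest of these. All later coefficients are then strictly
  smaller, so division can proceed downwards from the top.\<close>

definition leading :: "(nat \<Rightarrow>\<^sub>0 nat) \<Rightarrow> 'k::na_valued_field mseries \<Rightarrow> bool" where
  "leading p f \<longleftrightarrow>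
     f p \<noteq> 0 \<and> (\<forall>q. na_abs (f q) \<le> na_abs (f p)) \<and> (\<forall>q>p. na_abs (f q) < na_abs (f p))"

lemma exists_leading:
  assumes f: "f \<in> null_series X" and "f \<noteq> 0"
  shows "\<exists>p\<in>X. leading p f"
proof -
  obtain \<nu> where \<nu>: "f \<nu> \<noteq> 0" using \<open>f \<noteq> 0\<close> by (auto simp: fun_eq_iff)
  define F where "F = {q. na_abs (f \<nu>) \<le> na_abs (f q)}"
  define M where "M = Max ((\<lambda>q. na_abs (f q)) ` F)"
  have F: "finite F" "\<nu> \<in> F"
    using null_seriesD(2)[OF f, of "na_abs (f \<nu>)"] \<nu> by (auto simp: F_def)
  then have M: "M \<in> (\<lambda>q. na_abs (f q)) ` F" "\<And>q. q \<in> F \<Longrightarrow> na_abs (f q) \<le> M"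
    unfolding M_def by (auto intro!: Max_in)
  have \<nu>M: "na_abs (f \<nu>) \<le> M" using M(2) F(2) by blast
  have all: "na_abs (f q) \<le> M" for q
    using M(2)[of q] \<nu>M by (cases "q \<in> F") (auto simp: F_def)
  define F' where "F' = {q. na_abs (f q) = M}"
  have "F' \<subseteq> F" using \<nu>M by (auto simp: F_def F'_def)
  then have F': "finite F'" "F' \<noteq> {}"
    using F(1) finite_subset M(1) by (auto simp: F'_def)
  define p where "p = Max F'"
  have p: "p \<in> F'" "\<And>q. q \<in> F' \<Longrightarrow> q \<le> p"
    unfolding p_def using F' by auto
  have "0 < M" using \<nu> \<nu>M na_abs_pos_iff[of "f \<nu>"] by linarith
  moreover have "na_abs (f p) = M" using p(1) by (simp add: F'_def)
  moreover have "na_abs (f q) < M" if "q > p" for q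
    using p(2)[of q] that all[of q] by (auto simp: F'_def less_le)
  ultimately have "leading p f"
    using all by (auto simp: leading_def)
  moreover have "p \<in> X" using calculation null_seriesD(1)[OF f] by (auto simp: leading_def)
  ultimately show ?thesis by blast
qed

lemma leading_conv_monomial:
  assumes "leading p f" "c \<noteq> 0"
  shows "leading (\<mu> + p) (monomial c \<mu> \<star> f)"
  unfolding leading_def
proof safe
  fix q
  show "na_abs ((monomial c \<mu> \<star> f) q) \<le> na_abs ((monomial c \<mu> \<star> f) (\<mu> + p))"
    using assms
    by (cases "\<exists>\<beta>. q = \<mu> + \<beta>") (auto simp: leading_def na_abs_mult monomial_conv_eq_0 mult_left_mono)
  assume "q > \<mu> + p"
  then show "na_abs ((monomial c \<mu> \<star> f) q) < na_abs ((monomial c \<mu> \<star> f) (\<mu> + p))"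
    using assms
    by (cases "\<exists>\<beta>. q = \<mu> + \<beta>") (auto simp: leading_def na_abs_mult monomial_conv_eq_0)
qed (use assms in \<open>auto simp: leading_def\<close>)


section \<open>Division with remainder\<close>

lemma sum_fun_apply: "(\<Sum>i\<in>I. f i) x = (\<Sum>i\<in>I. f i x)"
  by (induction I rule: infinite_finite_induct) (simp_all only: sum.infinite sum.empty sum.insert
      zero_fun_apply plus_fun_apply not_False_eq_True)

locale na_embedding =
  fixes \<phi> :: "'k::na_field \<Rightarrow> 'c::na_field"
  assumes hom: "field_hom \<phi>" and isometric: "na_abs (\<phi> x) = na_abs x"
begin

lemma hom_add: "\<phi> (x + y) = \<phi> x + \<phi> y"
  and hom_mult: "\<phi> (x * y) = \<phi> x * \<phi> y"
  and hom_one [simp]: "\<phi> 1 = 1"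
  using hom by (auto simp: field_hom_def)

lemma hom_zero [simp]: "\<phi> 0 = 0"
  using hom_add[of 0 0] by (metis add_0 add_cancel_right_right)

lemma hom_sum: "\<phi> (sum f I) = (\<Sum>i\<in>I. \<phi> (f i))"
  by (induction I rule: infinite_finite_induct) (auto simp: hom_add)

lemma hom_comp_add: "\<phi> \<circ> (f + g) = (\<phi> \<circ> f) + (\<phi> \<circ> g)"
  by (simp add: fun_eq_iff hom_add)

lemma hom_comp_diff: "\<phi> \<circ> (f - g) = (\<phi> \<circ> f) - (\<phi> \<circ> g)"
  using hom_comp_add[of "f - g" g] by (simp only: diff_add_cancel eq_diff_eq)

lemma hom_comp_conv: "\<phi> \<circ> (a \<star> b) = (\<phi> \<circ> a) \<star> (\<phi> \<circ> b)"
  by (simp add: fun_eq_iff conv_def hom_sum case_prod_unfold hom_mult)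

lemma hom_comp_monomial: "\<phi> \<circ> monomial c \<mu> = monomial (\<phi> c) \<mu>"
  by (auto simp: monomial_def)

lemma null_series_hom: "a \<in> null_series X \<Longrightarrow> \<phi> \<circ> a \<in> null_series X"
  by (rule null_series_compose[where B = 1]) (auto simp: isometric)

end

text \<open>The hypotheses say that the \<open>F b\<close> are a normalized standard basis: every exponent in \<open>\<Lambda>\<close> is
  a translate \<open>\<mu> p + \<beta> p\<close> of one of their finitely many leading exponents, and \<open>\<epsilon>\<close> is a uniform gap
  below \<open>1\<close> for the coefficients beyond the leading one.\<close>

locale division = na_embedding \<phi> for \<phi> :: "'k::na_field \<Rightarrow> 'c::na_field" +
  fixes n m :: nat and \<Lambda> B :: "(nat \<Rightarrow>\<^sub>0 nat) set"
    and F :: "(nat \<Rightarrow>\<^sub>0 nat) \<Rightarrow> 'k mseries" and \<beta> \<mu> :: "(nat \<Rightarrow>\<^sub>0 nat) \<Rightarrow> (nat \<Rightarrow>\<^sub>0 nat)"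
    and \<epsilon> :: real
  assumes finite_B: "finite B"
    and F_null: "b \<in> B \<Longrightarrow> F b \<in> null_series (vexps n m)"
    and F_lead: "b \<in> B \<Longrightarrow> F b b = 1"
    and F_le_1: "b \<in> B \<Longrightarrow> na_abs (F b q) \<le> 1"
    and F_le_eps: "b \<in> B \<Longrightarrow> b < q \<Longrightarrow> na_abs (F b q) \<le> \<epsilon>"
    and eps: "0 < \<epsilon>" "\<epsilon> < 1"
    and \<beta>: "p \<in> \<Lambda> \<Longrightarrow> \<beta> p \<in> B"
    and \<mu>: "p \<in> \<Lambda> \<Longrightarrow> \<mu> p \<in> exps n"
    and \<mu>_\<beta>: "p \<in> \<Lambda> \<Longrightarrow> \<mu> p + \<beta> p = p"
begin

text \<open>If \<nu> + b = p and \<beta> p = b, then \<nu> = \<mu> p. So this is the sum of c p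
  X^(\<mu> p) over the p in \<Lambda> assigned to b, and every p in \<Lambda> is assigned to exactly
  one b.\<close>

definition quot :: "(nat \<Rightarrow>\<^sub>0 nat) \<Rightarrow> 'c mseries \<Rightarrow> 'c mseries" where
  "quot b c = (\<lambda>\<nu>. if \<nu> + b \<in> \<Lambda> \<and> \<beta> (\<nu> + b) = b then c (\<nu> + b) else 0)"

definition rem :: "'c mseries \<Rightarrow> 'c mseries" where
  "rem c = (\<lambda>p. if p \<in> \<Lambda> then 0 else c p)"

text \<open>The combination \<open>\<Sum>p. c p * g p\<close>, where \<open>g p\<close> is \<open>X^(\<mu> p) F (\<beta> p)\<close> for \<open>p \<in> \<Lambda>\<close> and the monomial
  \<open>X^p\<close> otherwise.  Modulo \<open>\<epsilon>\<close> this is a unitriangular operator, hence invertible.\<close>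

definition recombine :: "'c mseries \<Rightarrow> 'c mseries" where
  "recombine c = (\<Sum>b\<in>B. quot b c \<star> (\<phi> \<circ> F b)) + rem c"

lemma quot_add: "quot b (c + d) = quot b c + quot b d"
  and rem_add: "rem (c + d) = rem c + rem d"
  by (auto simp: quot_def rem_def fun_eq_iff)

lemma recombine_add: "recombine (c + d) = recombine c + recombine d"
  unfolding recombine_def quot_add rem_add conv_add_left sum.distrib by (simp only: ac_simps)

lemma recombine_diff: "recombine (c - d) = recombine c - recombine d"
  using recombine_add[of "c - d" d] by (simp add: eq_diff_eq)

lemma recombine_zero: "recombine 0 = 0"
  using recombine_diff[of 0 0] by simp

lemma null_series_quot:
  assumes "c \<in> null_series X"
  shows "quot b c \<in> null_series (exps n)"
proof -
  have "finite {\<nu>. e \<le> na_abs (quot b c \<nu>)}" if "e > 0" for e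
  proof -
    have "(\<lambda>\<nu>. \<nu> + b) ` {\<nu>. e \<le> na_abs (quot b c \<nu>)} \<subseteq> {p. e \<le> na_abs (c p)}"
      using that by (auto simp: quot_def split: if_splits)
    moreover have "finite {p. e \<le> na_abs (c p)}"
      using null_seriesD(2)[OF assms that] .
    moreover have "inj_on (\<lambda>\<nu>. \<nu> + b) A" for A
      by (simp add: inj_on_def)
    ultimately show ?thesis
      using finite_subset finite_imageD by metis
  qed
  moreover have "quot b c \<nu> = 0" if "\<nu> \<notin> exps n" for \<nu>
    using that \<mu>[of "\<nu> + b"] \<mu>_\<beta>[of "\<nu> + b"] by (auto simp: quot_def)
  ultimately show ?thesis by (simp add: null_series_def)
qed

lemma null_series_rem:
  assumes "c \<in> null_series X"
  shows "rem c \<in> null_series X"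
proof -
  have "finite {\<nu>. e \<le> na_abs (rem c \<nu>)}" if "e > 0" for e
    using null_seriesD(2)[OF assms that]
    by (rule rev_finite_subset) (use that in \<open>auto simp: rem_def split: if_splits\<close>)
  then show ?thesis using assms by (auto simp: null_series_def rem_def)
qed

lemma null_series_recombine:
  assumes "c \<in> null_series (vexps n m)"
  shows "recombine c \<in> null_series (vexps n m)"
  unfolding recombine_def
  by (intro null_series_add null_series_sum null_series_rem[OF assms]
      null_series_conv[OF null_series_quot[OF assms] null_series_hom[OF F_null]] vexps_add)

text \<open>The operator has norm at most 1, since the quotients take their coefficients from c and
  the basis series have coefficients of absolute value at most 1. This continuity allows passing to
  the limit in \<open>recombine_surj\<close>.\<close>

lemma recombine_bound:
  assumes "0 \<le> A" "\<And>p. na_abs (c p) \<le> A"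
  shows "na_abs (recombine c p) \<le> A"
proof -
  have "na_abs (quot b c \<alpha> * (\<phi> \<circ> F b) \<gamma>) \<le> A" if "b \<in> B" for b \<alpha> \<gamma>
  proof -
    have "na_abs (quot b c \<alpha>) * na_abs (F b \<gamma>) \<le> A * 1"
      using assms F_le_1[OF that] by (intro mult_mono) (auto simp: quot_def)
    then show ?thesis by (simp add: na_abs_mult isometric)
  qed
  then have "na_abs (\<Sum>b\<in>B. (quot b c \<star> (\<phi> \<circ> F b)) p) \<le> A"
    by (intro na_abs_sum_bound conv_bound assms(1))
  moreover have "na_abs (rem c p) \<le> A" using assms by (simp add: rem_def)
  moreover have "(\<Sum>b\<in>B. quot b c \<star> (\<phi> \<circ> F b)) p = (\<Sum>b\<in>B. (quot b c \<star> (\<phi> \<circ> F b)) p)"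
    by (rule sum_fun_apply)
  ultimately show ?thesis unfolding recombine_def by (simp add: na_abs_add_bound)
qed

lemma recombine_monomial_in:
  assumes "p \<in> \<Lambda>"
  shows "recombine (monomial x p) = monomial x (\<mu> p) \<star> (\<phi> \<circ> F (\<beta> p))"
proof -
  have "quot b (monomial x p) = (if b = \<beta> p then monomial x (\<mu> p) else 0)" for b
  proof
    fix \<nu>
    have "\<nu> + b = p \<and> \<beta> p = b \<longleftrightarrow> b = \<beta> p \<and> \<nu> = \<mu> p"
      using \<mu>_\<beta>[OF assms] by (metis add_right_cancel)
    then show "quot b (monomial x p) \<nu> = (if b = \<beta> p then monomial x (\<mu> p) else 0) \<nu>"
      using assms by (auto simp: quot_def monomial_def)
  qed
  moreover have "rem (monomial x p) = 0"
    using assms by (auto simp: rem_def monomial_def)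
  moreover have "(\<Sum>b\<in>B. (if b = \<beta> p then monomial x (\<mu> p) else 0) \<star> (\<phi> \<circ> F b))
      = (\<Sum>b\<in>B. if b = \<beta> p then monomial x (\<mu> p) \<star> (\<phi> \<circ> F b) else 0)"
    by (rule sum.cong) (simp_all only: if_distrib[of "\<lambda>a. a \<star> _"] conv_zero refl)
  ultimately show ?thesis
    using finite_B \<beta>[OF assms] by (simp only: recombine_def sum.delta if_True add_0_right)
qed

lemma recombine_monomial_notin:
  assumes "p \<notin> \<Lambda>"
  shows "recombine (monomial x p) = monomial x p"
proof -
  have "quot b (monomial x p) = 0" for b
    using assms by (auto simp: quot_def monomial_def)
  moreover have "rem (monomial x p) = monomial x p"
    using assms by (auto simp: rem_def monomial_def)
  ultimately show ?thesis
    by (simp only: recombine_def conv_zero sum.neutral_const add_0_left)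
qed

text \<open>Unitriangularity modulo \<epsilon>. For p in \<Lambda> the series is x times the shift
  of F (\<beta> p) that takes \<beta> p to p; shifts preserve the order, so beyond p there are only
  coefficients from beyond \<beta> p.\<close>

lemma recombine_monomial:
  shows "recombine (monomial x p) p = x"
    and "na_abs (recombine (monomial x p) q) \<le> na_abs x"
    and "p < q \<Longrightarrow> na_abs (recombine (monomial x p) q) \<le> \<epsilon> * na_abs x"
proof -
  have pos: "0 \<le> \<epsilon> * na_abs x" using eps by simp
  consider "p \<notin> \<Lambda>" | \<gamma> where "p \<in> \<Lambda>" "q = \<mu> p + \<gamma>" | "p \<in> \<Lambda>" "\<And>\<gamma>. q \<noteq> \<mu> p + \<gamma>"
    by blast
  then have "na_abs (recombine (monomial x p) q) \<le> na_abs x \<and>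
      (p < q \<longrightarrow> na_abs (recombine (monomial x p) q) \<le> \<epsilon> * na_abs x)"
  proof cases
    case 1
    then show ?thesis
      unfolding recombine_monomial_notin[OF 1] using pos by (auto simp: monomial_def)
  next
    case 2
    have "\<beta> p < \<gamma>" if "p < q"
      using that 2 \<mu>_\<beta>[of p] by (metis add_less_cancel_left)
    moreover have "na_abs (recombine (monomial x p) q) = na_abs (F (\<beta> p) \<gamma>) * na_abs x"
      using 2 by (simp add: recombine_monomial_in na_abs_mult isometric)
    ultimately show ?thesis
      using 2 F_le_1[OF \<beta>, of p \<gamma>] F_le_eps[OF \<beta>, of p \<gamma>]
        mult_right_mono[of "na_abs (F (\<beta> p) \<gamma>)" 1 "na_abs x"]
        mult_right_mono[of "na_abs (F (\<beta> p) \<gamma>)" \<epsilon> "na_abs x"]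
      by auto
  next
    case 3
    then show ?thesis using pos by (simp add: recombine_monomial_in monomial_conv_eq_0)
  qed
  then show "na_abs (recombine (monomial x p) q) \<le> na_abs x"
    and "p < q \<Longrightarrow> na_abs (recombine (monomial x p) q) \<le> \<epsilon> * na_abs x"
    by blast+
  show "recombine (monomial x p) p = x"
  proof (cases "p \<in> \<Lambda>")
    case True
    have "(monomial x (\<mu> p) \<star> (\<phi> \<circ> F (\<beta> p))) (\<mu> p + \<beta> p) = x"
      by (simp add: F_lead[OF \<beta>[OF True]])
    then show ?thesis using True by (simp add: recombine_monomial_in \<mu>_\<beta>)
  next
    case False
    show ?thesis unfolding recombine_monomial_notin[OF False] by (simp add: monomial_def)
  qed
qed

text \<open>Only the finitely many coefficients above \<epsilon> * A matter, and they are eliminated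
  from the largest exponent p0 down. Subtracting the recombined monomial at p0 kills that
  coefficient and changes later ones by at most \<epsilon> * A, so all remaining large exponents lie
  below p0. New large coefficients may appear there, hence the induction on a strict upper bound p
  rather than on their number.\<close>

lemma approximate_below:
  assumes "p \<in> exps (Suc n)" "v \<in> null_series (vexps n m)" and A: "0 < A"
    and "\<And>q. na_abs (v q) \<le> A" "\<And>q. \<epsilon> * A < na_abs (v q) \<Longrightarrow> q < p"
  shows "\<exists>c\<in>null_series (vexps n m). (\<forall>q. na_abs (c q) \<le> A) \<and> (\<forall>q. na_abs ((v - recombine c) q) \<le> \<epsilon> * A)"
  using assms(1,2,4,5)
proof (induction p arbitrary: v rule: exps_induct)
  case (less p)
  define Q where "Q = {q. \<epsilon> * A < na_abs (v q)}"
  show ?case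
  proof (cases "Q = {}")
    case True
    then have "na_abs ((v - recombine 0) q) \<le> \<epsilon> * A" for q
      unfolding recombine_zero diff_zero by (auto simp: Q_def not_less)
    moreover have "na_abs ((0 :: 'c mseries) q) \<le> A" for q using A by simp
    ultimately show ?thesis using null_series_zero by blast
  next
    case False
    have "finite {q. \<epsilon> * A \<le> na_abs (v q)}"
      using less.prems(1) A eps by (intro null_seriesD(2)) auto
    then have "finite Q" by (rule rev_finite_subset) (auto simp: Q_def)
    define p0 where "p0 = Max Q"
    have p0: "p0 \<in> Q" "\<And>q. q \<in> Q \<Longrightarrow> q \<le> p0"
      unfolding p0_def using \<open>finite Q\<close> False by auto
    have pos: "0 < \<epsilon> * A" using A eps by simp
    then have "0 < na_abs (v p0)" using p0(1) unfolding Q_def mem_Collect_eq by linarith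
    then have "v p0 \<noteq> 0" by simp
    then have p0v: "p0 \<in> vexps n m" using null_seriesD(1)[OF less.prems(1)] by blast
    then have p0e: "p0 \<in> exps (Suc n)" by (simp add: vexps_def)
    define c0 where "c0 = monomial (v p0) p0"
    have c0: "c0 \<in> null_series (vexps n m)"
      unfolding c0_def using p0v by (rule null_series_monomial)
    define v' where "v' = v - recombine c0"
    have v': "v' \<in> null_series (vexps n m)"
      unfolding v'_def using less.prems(1) null_series_recombine[OF c0] by (rule null_series_diff)
    have le: "na_abs (v' q) \<le> A" for q
      unfolding v'_def c0_def minus_apply
      using less.prems(2) recombine_monomial(2) order_trans by (intro na_abs_diff_bound) blast+
    have "q < p0" if "\<epsilon> * A < na_abs (v' q)" for q
    proof (rule ccontr)
      assume "\<not> q < p0"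
      then consider "q = p0" | "p0 < q" by force
      then show False
      proof cases
        case 1
        then have "v' q = 0" by (simp add: v'_def c0_def recombine_monomial(1))
        then show False using that pos by simp
      next
        case 2
        have "na_abs (recombine c0 q) \<le> \<epsilon> * na_abs (v p0)"
          unfolding c0_def using 2 by (rule recombine_monomial(3))
        also have "\<dots> \<le> \<epsilon> * A" using less.prems(2) eps by (intro mult_left_mono) auto
        finally have "na_abs (v' q) \<le> \<epsilon> * A"
          unfolding v'_def minus_apply using 2 p0(2)[of q]
          by (intro na_abs_diff_bound) (force simp: Q_def)+
        then show False using that by simp
      qed
    qed
    moreover have "p0 < p" using p0(1) less.prems(3) by (simp add: Q_def)
    ultimately obtain c where c: "c \<in> null_series (vexps n m)" "\<And>q. na_abs (c q) \<le> A"
        "\<And>q. na_abs ((v' - recombine c) q) \<le> \<epsilon> * A"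
      using less.IH[OF p0e _ v' le] by blast
    have eq: "v - recombine (c0 + c) = v' - recombine c"
      unfolding v'_def recombine_add by (simp only: diff_diff_eq)
    have "na_abs ((v - recombine (c0 + c)) q) \<le> \<epsilon> * A" for q
      unfolding eq by (rule c(3))
    moreover have "na_abs ((c0 + c) q) \<le> A" for q
      unfolding plus_fun_apply using c(2) less.prems(2) A
      by (intro na_abs_add_bound) (auto simp: c0_def monomial_def)
    ultimately show ?thesis
      using null_series_add[OF c0 c(1)] by blast
  qed
qed

lemma approximate_mod:
  assumes v: "v \<in> null_series (vexps n m)" and A: "0 < A" "\<And>q. na_abs (v q) \<le> A"
  shows "\<exists>c\<in>null_series (vexps n m). (\<forall>q. na_abs (c q) \<le> A) \<and> (\<forall>q. na_abs ((v - recombine c) q) \<le> \<epsilon> * A)"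
proof -
  \<comment> \<open>0 is inserted so that a maximum exists; raising the exponent of variable 0 then
    gives a strict upper bound.\<close>
  define Q where "Q = insert 0 {q. \<epsilon> * A \<le> na_abs (v q)}"
  have "finite Q"
    unfolding Q_def using null_seriesD(2)[OF v, of "\<epsilon> * A"] A eps by simp
  define p where "p = Max Q + Poly_Mapping.single 0 1"
  have "q < p" if "q \<in> Q" for q
  proof -
    have "(0::nat \<Rightarrow>\<^sub>0 nat) \<noteq> Poly_Mapping.single 0 1"
      by (metis lookup_single_eq lookup_zero zero_neq_one)
    then have "(0::nat \<Rightarrow>\<^sub>0 nat) < Poly_Mapping.single 0 1"
      using zero_le_exponent by (simp add: less_le)
    then have "Max Q < p"
      unfolding p_def using add_strict_left_mono[of 0 "Poly_Mapping.single 0 (1::nat)" "Max Q"] by simp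
    then show ?thesis using Max_ge[OF \<open>finite Q\<close> that] by simp
  qed
  moreover have "Q \<subseteq> exps (Suc n)"
  proof -
    have "q \<in> vexps n m" if "\<epsilon> * A \<le> na_abs (v q)" for q
      using that null_seriesD(1)[OF v, of q] A eps mult_pos_pos[of \<epsilon> A] by fastforce
    then show ?thesis by (auto simp: Q_def vexps_def)
  qed
  then have "p \<in> exps (Suc n)"
    unfolding p_def using Max_in[OF \<open>finite Q\<close>]
    by (intro exps_add) (auto simp: Q_def exps_def)
  ultimately show ?thesis
    using assms by (intro approximate_below[of p]) (auto simp: Q_def)
qed

text \<open>Successive approximation: each round shrinks the defect by the factor \<epsilon>, with
  corrections no larger than the defect, so the approximants C j converge uniformly in the
  exponent.\<close>

lemma recombine_surj:
  assumes v: "v \<in> null_series (vexps n m)"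
  shows "\<exists>c\<in>null_series (vexps n m). v = recombine c"
proof -
  obtain A where A: "A > 0" "\<And>p. na_abs (v p) \<le> A" using null_series_bounded[OF v] by metis
  have pos: "0 < A * \<epsilon> ^ j" for j using A eps by simp
  let ?P = "\<lambda>j c. c \<in> null_series (vexps n m) \<and> (\<forall>q. na_abs ((v - recombine c) q) \<le> A * \<epsilon> ^ j)"
  let ?Q = "\<lambda>j c c'. \<forall>q. na_abs ((c' - c) q) \<le> A * \<epsilon> ^ j"
  have "\<exists>C. \<forall>j. ?P j (C j) \<and> ?Q j (C j) (C (Suc j))"
  proof (rule dependent_nat_choice)
    have "?P 0 0" unfolding recombine_zero diff_zero using A by simp
    then show "\<exists>c. ?P 0 c" by blast
  next
    fix c j assume c: "?P j c"
    then have "v - recombine c \<in> null_series (vexps n m)"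
      using null_series_recombine null_series_diff v by blast
    from approximate_mod[OF this pos[of j]] c
    obtain d where d: "d \<in> null_series (vexps n m)" "\<And>q. na_abs (d q) \<le> A * \<epsilon> ^ j"
      "\<And>q. na_abs ((v - recombine c - recombine d) q) \<le> \<epsilon> * (A * \<epsilon> ^ j)" by blast
    have eq: "v - recombine (c + d) = v - recombine c - recombine d"
      unfolding recombine_add by (simp only: diff_diff_eq)
    have "na_abs ((v - recombine (c + d)) q) \<le> A * \<epsilon> ^ Suc j" for q
      unfolding eq using d(3)[of q] by (simp only: power_Suc mult.left_commute)
    then have "?P (Suc j) (c + d)"
      using d(1) c null_series_add by blast
    moreover have "?Q j c (c + d)" using d(2) by simp
    ultimately show "\<exists>c'. ?P (Suc j) c' \<and> ?Q j c c'" by blast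
  qed
  then obtain C where C: "\<And>j. C j \<in> null_series (vexps n m)"
    "\<And>j q. na_abs ((v - recombine (C j)) q) \<le> A * \<epsilon> ^ j"
    "\<And>j q. na_abs (C (Suc j) q - C j q) \<le> A * \<epsilon> ^ j" by auto
  have "\<exists>l. \<forall>j. na_abs (l - C j q) \<le> A * \<epsilon> ^ j" for q
    using C(3)[of _ q] A eps by (intro na_geometric_limit) auto
  then obtain c where c: "\<And>q j. na_abs (c q - C j q) \<le> A * \<epsilon> ^ j" by metis
  have small: "\<exists>j. A * \<epsilon> ^ j < e" if "e > 0" for e
  proof -
    have "(\<lambda>j. A * \<epsilon> ^ j) \<longlonglongrightarrow> 0"
      using eps by (intro tendsto_mult_right_zero LIMSEQ_power_zero) auto
    then have "\<forall>\<^sub>F j in sequentially. A * \<epsilon> ^ j < e"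
      using that by (rule order_tendstoD(2))
    then show ?thesis by (rule eventually_happens'[OF sequentially_bot])
  qed
  have eq_0: "x = 0" if "\<And>j. na_abs x \<le> A * \<epsilon> ^ j" for x :: 'c
    using small[of "na_abs x"] that by (metis linorder_not_less na_abs_pos_iff)
  have "c q = 0" if "q \<notin> vexps n m" for q
    using c[of q] null_seriesD(1)[OF C(1) that] by (intro eq_0) simp
  moreover have "finite {q. e \<le> na_abs (c q)}" if e: "e > 0" for e
  proof -
    obtain j where j: "A * \<epsilon> ^ j < e" using small[OF e] by blast
    \<comment> \<open>Uniformity enters here: one j serves all exponents, so the large coefficients
      of the limit are among those of a single null series.\<close>
    have "e \<le> na_abs (C j q)" if "e \<le> na_abs (c q)" for q
      using na_abs_add_le[of "c q - C j q" "C j q"] c[of q j] j that by simp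
    then show ?thesis
      using null_seriesD(2)[OF C(1) e, of j] by (auto intro: rev_finite_subset)
  qed
  ultimately have c_null: "c \<in> null_series (vexps n m)" by (simp add: null_series_def)
  have "(v - recombine c) q = 0" for q
  proof (rule eq_0)
    fix j
    have "recombine c - recombine (C j) = recombine (c - C j)" by (simp only: recombine_diff)
    then have "na_abs ((recombine c - recombine (C j)) q) \<le> A * \<epsilon> ^ j"
      using recombine_bound[of "A * \<epsilon> ^ j" "c - C j" q] pos[of j] c[of _ j] by simp
    from na_abs_diff_bound[OF C(2)[of j q] this] show "na_abs ((v - recombine c) q) \<le> A * \<epsilon> ^ j"
      by simp
  qed
  then have "v = recombine c" by (auto simp: fun_eq_iff)
  then show ?thesis using c_null by blast
qed

end

section \<open>Submodules of tuples and their standard bases\<close>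

definition series_submodule :: "nat \<Rightarrow> nat \<Rightarrow> 'k::na_field mseries set \<Rightarrow> bool" where
  "series_submodule n m U \<longleftrightarrow> U \<subseteq> null_series (vexps n m) \<and> 0 \<in> U \<and>
     (\<forall>f\<in>U. \<forall>g\<in>U. f + g \<in> U) \<and> (\<forall>a\<in>null_series (exps n). \<forall>f\<in>U. a \<star> f \<in> U)"

lemma series_submoduleD:
  assumes "series_submodule n m U"
  shows "0 \<in> U" "f \<in> U \<Longrightarrow> f \<in> null_series (vexps n m)" "f \<in> U \<Longrightarrow> g \<in> U \<Longrightarrow> f + g \<in> U"
    "a \<in> null_series (exps n) \<Longrightarrow> f \<in> U \<Longrightarrow> a \<star> f \<in> U"
  using assms unfolding series_submodule_def by (blast, blast, metis, metis)

lemma series_submodule_sum: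
  assumes "series_submodule n m U" "\<And>i. i \<in> I \<Longrightarrow> f i \<in> U"
  shows "sum f I \<in> U"
  using assms(2)
proof (induction I rule: infinite_finite_induct)
  case (insert i I)
  then have "f i \<in> U" "sum f I \<in> U" by auto
  then have "f i + sum f I \<in> U" by (rule series_submoduleD(3)[OF assms(1)])
  then show ?case by (simp only: sum.insert[OF insert.hyps])
qed (use assms(1) in \<open>auto simp only: sum.infinite sum.empty not_False_eq_True series_submodule_def\<close>)

lemma series_submodule_diff:
  assumes "series_submodule n m U" "f \<in> U" "g \<in> U"
  shows "f - g \<in> U"
proof -
  have "monomial (- 1) 0 \<star> g \<in> U"
    by (rule series_submoduleD(4)[OF assms(1) null_series_monomial[OF zero_in_exps] assms(3)])
  moreover have "monomial (- 1) 0 \<star> g = - g"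
    by (simp add: fun_eq_iff monomial_0_conv)
  ultimately have "f + - g \<in> U"
    by (simp only: series_submoduleD(3)[OF assms(1,2)])
  then show ?thesis by (simp only: diff_conv_add_uminus)
qed

text \<open>A nonzero f would have a leading exponent, where it does not vanish, and f itself
  belongs to U. This expresses the uniqueness of remainders.\<close>

lemma series_submodule_eq_0:
  assumes U: "series_submodule n m U" and "f \<in> U" "\<And>p g. g \<in> U \<Longrightarrow> leading p g \<Longrightarrow> f p = 0"
  shows "f = 0"
proof (rule ccontr)
  assume "f \<noteq> 0"
  then obtain p where "leading p f"
    using exists_leading U \<open>f \<in> U\<close> by (metis series_submodule_def subset_iff)
  then show False using assms by (metis leading_def)
qed

text \<open>The divisors have coefficients in k and the dividend in the larger field: \<phi> is
  isometric, so the leading exponents and the gap \<epsilon> computed over k remain valid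
  there.\<close>

lemma (in na_embedding) submodule_division:
  assumes U: "series_submodule n m U"
  obtains B :: "(nat \<Rightarrow>\<^sub>0 nat) set" and F where "finite B" "\<And>b. b \<in> B \<Longrightarrow> F b \<in> U"
    "\<And>v. v \<in> null_series (vexps n m) \<Longrightarrow> \<exists>q r. (\<forall>b\<in>B. q b \<in> null_series (exps n)) \<and>
       r \<in> null_series (vexps n m) \<and> (\<forall>p. \<forall>f\<in>U. leading p f \<longrightarrow> r p = 0) \<and>
       v = (\<Sum>b\<in>B. q b \<star> (\<phi> \<circ> F b)) + r"
proof -
  have U_null: "f \<in> null_series (vexps n m)" if "f \<in> U" for f
    using U that by (auto simp: series_submodule_def)
  define \<Lambda> where "\<Lambda> = {p. \<exists>f\<in>U. leading p f}"
  have "\<Lambda> \<subseteq> vexps n m"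
    using U_null null_seriesD(1) by (fastforce simp: \<Lambda>_def leading_def)
  then obtain B where B: "finite B" "B \<subseteq> \<Lambda>" "\<And>p. p \<in> \<Lambda> \<Longrightarrow> \<exists>b\<in>B. \<exists>\<mu>\<in>exps n. p = \<mu> + b"
    using dickson by metis
  have "\<exists>f\<in>U. leading b f \<and> f b = 1" if b: "b \<in> B" for b
  proof -
    obtain f where f: "f \<in> U" "leading b f" using B(2) b unfolding \<Lambda>_def by blast
    then have "f b \<noteq> 0" by (simp add: leading_def)
    let ?g = "monomial (inverse (f b)) 0 \<star> f"
    have "?g \<in> U"
      using U f(1) null_series_monomial[OF zero_in_exps] unfolding series_submodule_def by blast
    moreover have "leading b ?g"
      using leading_conv_monomial[OF f(2), of "inverse (f b)" 0] \<open>f b \<noteq> 0\<close> by simp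
    moreover have "?g b = 1" using \<open>f b \<noteq> 0\<close> by (simp add: monomial_0_conv)
    ultimately show ?thesis by blast
  qed
  then obtain F where F: "\<And>b. b \<in> B \<Longrightarrow> F b \<in> U" "\<And>b. b \<in> B \<Longrightarrow> leading b (F b)"
    "\<And>b. b \<in> B \<Longrightarrow> F b b = 1"
    by metis
  from B(3) obtain \<beta> \<mu> where \<beta>: "\<And>p. p \<in> \<Lambda> \<Longrightarrow> \<beta> p \<in> B" "\<And>p. p \<in> \<Lambda> \<Longrightarrow> \<mu> p \<in> exps n"
    "\<And>p. p \<in> \<Lambda> \<Longrightarrow> p = \<mu> p + \<beta> p"
    by metis
  \<comment> \<open>The values in [1/2, 1) taken by coefficients of the basis, a finite set. Their
    maximum together with 1/2 is a gap below 1; the value 1/2 covers the smaller coefficients and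
    keeps \<epsilon> positive.\<close>
  define T where "T = (\<Union>b\<in>B. (\<lambda>q. na_abs (F b q)) ` {q. 1/2 \<le> na_abs (F b q)}) \<inter> {..<1}"
  define \<epsilon> where "\<epsilon> = Max (insert (1/2) T)"
  have fin: "finite (insert (1/2) T)"
    unfolding T_def using B(1) null_seriesD(2)[OF U_null[OF F(1)], of _ "1/2"] by auto
  have eps_ge: "t \<le> \<epsilon>" if "t \<in> insert (1/2) T" for t
    unfolding \<epsilon>_def using fin that by (rule Max_ge)
  have "\<epsilon> \<in> insert (1/2) T"
    unfolding \<epsilon>_def by (rule Max_in[OF fin]) simp
  then have "\<epsilon> < 1" by (auto simp: T_def)
  have F_le: "na_abs (F b q) \<le> 1" if "b \<in> B" for b q
    using F(2,3)[OF that] by (simp add: leading_def)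
  have F_eps: "na_abs (F b q) \<le> \<epsilon>" if "b \<in> B" "b < q" for b q
  proof (cases "1/2 \<le> na_abs (F b q)")
    case True
    moreover have "na_abs (F b q) < 1"
      using F(2,3)[OF that(1)] that(2) by (simp add: leading_def)
    ultimately have "na_abs (F b q) \<in> T" using that(1) by (auto simp: T_def)
    then show ?thesis using eps_ge by blast
  qed (use eps_ge[of "1/2"] in simp)
  interpret division \<phi> n m \<Lambda> B F \<beta> \<mu> \<epsilon>
    using B(1) F U_null F_le F_eps \<open>\<epsilon> < 1\<close> eps_ge[of "1/2"] \<beta> by unfold_locales auto
  show ?thesis
  proof (rule that[of B F])
    show "finite B" by (rule B(1))
    show "F b \<in> U" if "b \<in> B" for b using that by (rule F(1))
    fix v :: "'c mseries" assume "v \<in> null_series (vexps n m)"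
    then obtain c where c: "c \<in> null_series (vexps n m)" "v = recombine c"
      using recombine_surj by blast
    have "rem c p = 0" if "f \<in> U" "leading p f" for p f
    proof -
      have "p \<in> \<Lambda>" using that unfolding \<Lambda>_def by blast
      then show ?thesis by (simp add: rem_def)
    qed
    then show "\<exists>q r. (\<forall>b\<in>B. q b \<in> null_series (exps n)) \<and>
       r \<in> null_series (vexps n m) \<and> (\<forall>p. \<forall>f\<in>U. leading p f \<longrightarrow> r p = 0) \<and>
       v = (\<Sum>b\<in>B. q b \<star> (\<phi> \<circ> F b)) + r"
      using null_series_quot[OF c(1)] null_series_rem[OF c(1)] c(2) unfolding recombine_def
      by (intro exI[of _ "\<lambda>b. quot b c"] exI[of _ "rem c"]) blast
  qed
qed


section \<open>Bounded functionals\<close>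

text \<open>Bounded \<open>'k\<close>-linear functionals on subspaces of \<open>'c\<close>, represented by their graphs; the bound
  makes such a graph single-valued.\<close>

definition (in na_embedding) bounded_graph :: "('c \<times> 'k) set \<Rightarrow> real \<Rightarrow> bool" where
  "bounded_graph G B \<longleftrightarrow> (0, 0) \<in> G \<and>
     (\<forall>x y x' y'. (x, y) \<in> G \<longrightarrow> (x', y') \<in> G \<longrightarrow> (x + x', y + y') \<in> G) \<and>
     (\<forall>a x y. (x, y) \<in> G \<longrightarrow> (\<phi> a * x, a * y) \<in> G) \<and>
     (\<forall>x y. (x, y) \<in> G \<longrightarrow> na_abs y \<le> B * na_abs x)"

context na_embedding
begin

lemma hom_minus: "\<phi> (- x) = - \<phi> x"
  using hom_add[of x "- x"] by (simp add: eq_neg_iff_add_eq_0 add.commute)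

lemma bounded_graphD:
  assumes "bounded_graph G B"
  shows "(0, 0) \<in> G" "(x, y) \<in> G \<Longrightarrow> (x', y') \<in> G \<Longrightarrow> (x + x', y + y') \<in> G"
    "(x, y) \<in> G \<Longrightarrow> (\<phi> a * x, a * y) \<in> G" "(x, y) \<in> G \<Longrightarrow> na_abs y \<le> B * na_abs x"
  using assms by (auto simp: bounded_graph_def)

lemma bounded_graph_diff:
  assumes G: "bounded_graph G B" and "(x, y) \<in> G" "(x', y') \<in> G"
  shows "(x - x', y - y') \<in> G"
proof -
  have "(- x', - y') \<in> G"
    using bounded_graphD(3)[OF G assms(3), of "- 1"] by (simp add: hom_minus)
  then show ?thesis using bounded_graphD(2)[OF G assms(2)] by fastforce
qed

lemma bounded_graph_unique:
  assumes G: "bounded_graph G B" and "(x, y) \<in> G" "(x, y') \<in> G"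
  shows "y = y'"
proof -
  have "na_abs (y - y') \<le> 0"
    using bounded_graphD(4)[OF G bounded_graph_diff[OF assms]] by simp
  then have "na_abs (y - y') = 0" using na_abs_nonneg by (rule antisym)
  then show ?thesis by (simp add: na_abs_eq_0_iff)
qed

text \<open>A value at \<open>v\<close> that extends the functional with bound \<open>B'\<close>: the limit of the values along a
  sequence tending to \<open>v\<close> if \<open>v\<close> lies in the closure of the domain, and otherwise the value at a point
  whose distance to \<open>v\<close> is minimal up to the factor \<open>B'/B\<close>.\<close>

lemma exists_extension_value:
  assumes G: "bounded_graph G B" and B: "0 < B" "B < B'"
  shows "\<exists>y. \<forall>w z. (w, z) \<in> G \<longrightarrow> na_abs (y - z) \<le> B' * na_abs (v - w)"
proof (cases "\<forall>e>0. \<exists>w z. (w, z) \<in> G \<and> na_abs (v - w) < e")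
  case True
  then have "\<forall>j. \<exists>w z. (w, z) \<in> G \<and> na_abs (v - w) < (1/2) ^ j" by simp
  then obtain w z where wz: "\<And>j. (w j, z j) \<in> G" "\<And>j. na_abs (v - w j) < (1/2) ^ j"
    by metis
  have "na_abs (z (Suc j) - z j) \<le> B * (1/2) ^ j" for j
  proof -
    have "na_abs (v - w (Suc j)) \<le> (1/2) ^ j"
      using wz(2)[of "Suc j"] na_abs_nonneg[of "v - w (Suc j)"] unfolding power_Suc by linarith
    with less_imp_le[OF wz(2)[of j]] have "na_abs ((v - w j) - (v - w (Suc j))) \<le> (1/2) ^ j"
      by (rule na_abs_diff_bound)
    then have "B * na_abs (w (Suc j) - w j) \<le> B * (1/2) ^ j"
      using B(1) by (intro mult_left_mono) auto
    moreover have "na_abs (z (Suc j) - z j) \<le> B * na_abs (w (Suc j) - w j)"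
      using bounded_graphD(4)[OF G bounded_graph_diff[OF G wz(1) wz(1)]] .
    ultimately show ?thesis
      by (rule order_trans[rotated])
  qed
  then obtain y where y: "\<And>j. na_abs (y - z j) \<le> B * (1/2) ^ j"
    using na_geometric_limit[of "1/2" B z] B(1) by auto
  have "na_abs (y - z') \<le> B' * na_abs (v - w')" if "(w', z') \<in> G" for w' z'
  proof (rule ccontr)
    assume "\<not> ?thesis"
    moreover have "B * na_abs (v - w') \<le> B' * na_abs (v - w')"
      using B by (intro mult_right_mono) auto
    ultimately have less: "B * na_abs (v - w') < na_abs (y - z')" by simp
    moreover have "0 \<le> B * na_abs (v - w')" using B(1) by simp
    ultimately have "0 < na_abs (y - z')" by linarith
    then have "0 < na_abs (y - z') / B" using B(1) by (rule divide_pos_pos)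
    \<comment> \<open>Now both the error at \<open>w j\<close> and B * na_abs (v - w') lie below
      na_abs (y - z'), while the ultrametric inequality through \<open>z j\<close> bounds na_abs (y
      - z') by the larger of them.\<close>
    then obtain j where "(1/2) ^ j < na_abs (y - z') / B"
      using real_arch_pow_inv[of _ "1/2"] by auto
    then have j: "B * (1/2) ^ j < na_abs (y - z')"
      using B(1) by (simp add: field_simps)
    have "na_abs ((v - w') - (v - w j)) \<le> max (na_abs (v - w')) ((1/2) ^ j)"
      using wz(2)[of j] by (rule order_trans[OF na_abs_diff_le max.mono[OF order_refl less_imp_le]])
    then have "B * na_abs (w j - w') \<le> B * max (na_abs (v - w')) ((1/2) ^ j)"
      using B(1) by (intro mult_left_mono) auto
    moreover have "na_abs (z j - z') \<le> B * na_abs (w j - w')"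
      using bounded_graphD(4)[OF G bounded_graph_diff[OF G wz(1) that]] .
    moreover have "na_abs (y - z') \<le> max (na_abs (y - z j)) (na_abs (z j - z'))"
      using na_abs_add_le[of "y - z j" "z j - z'"] by simp
    ultimately show False
      using less j y[of j] by (auto simp: max_def split: if_splits)
  qed
  then show ?thesis by blast
next
  case False
  define D where "D = {na_abs (v - w) |w z. (w, z) \<in> G}"
  obtain e where e: "e > 0" "\<And>d. d \<in> D \<Longrightarrow> e \<le> d"
    using False by (auto simp: D_def not_less)
  have "D \<noteq> {}" using bounded_graphD(1)[OF G] by (auto simp: D_def)
  have bdd: "bdd_below D" using e(2) by (rule bdd_belowI)
  have "e \<le> Inf D" using \<open>D \<noteq> {}\<close> e(2) by (rule cInf_greatest)
  \<comment> \<open>The infimum is positive but need not be attained, hence the need for a bound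
    strictly above B.\<close>
  then have "Inf D < B' / B * Inf D"
    using B e(1) by (simp add: field_simps)
  then obtain d where d: "d \<in> D" "d < B' / B * Inf D"
    using cInf_lessD[OF \<open>D \<noteq> {}\<close>] by blast
  then obtain w0 z0 where w0: "(w0, z0) \<in> G" "na_abs (v - w0) < B' / B * Inf D"
    unfolding D_def by blast
  have "na_abs (z0 - z) \<le> B' * na_abs (v - w)" if "(w, z) \<in> G" for w z
  proof -
    have "Inf D \<le> na_abs (v - w)"
      using that bdd by (intro cInf_lower) (auto simp: D_def)
    then have "B' / B * Inf D \<le> B' / B * na_abs (v - w)"
      using B by (intro mult_left_mono) auto
    moreover have "na_abs (v - w) \<le> B' / B * na_abs (v - w)"
      using B mult_right_mono[of 1 "B' / B" "na_abs (v - w)"] by simp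
    moreover have "na_abs ((v - w) - (v - w0)) \<le> max (na_abs (v - w)) (na_abs (v - w0))"
      by (rule na_abs_diff_le)
    ultimately have "na_abs ((v - w) - (v - w0)) \<le> B' / B * na_abs (v - w)"
      using w0(2) by linarith
    then have "B * na_abs (w0 - w) \<le> B' * na_abs (v - w)"
      using B by (simp add: field_simps)
    then show ?thesis
      using bounded_graphD(4)[OF G bounded_graph_diff[OF G w0(1) that]] by simp
  qed
  then show ?thesis by blast
qed

lemma bounded_graph_extend_point:
  assumes G: "bounded_graph G B" and B: "0 < B" "B < B'"
  shows "\<exists>G'. bounded_graph G' B' \<and> G \<subseteq> G' \<and> v \<in> Domain G'"
proof -
  obtain u where u: "\<And>w z. (w, z) \<in> G \<Longrightarrow> na_abs (u - z) \<le> B' * na_abs (v - w)"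
    using exists_extension_value[OF assms] by blast
  define G' where "G' = {(x + \<phi> c * v, y + c * u) |x y c. (x, y) \<in> G}"
  have mem: "(x + \<phi> c * v, y + c * u) \<in> G'" if "(x, y) \<in> G" for x y c
    using that by (auto simp: G'_def)
  have "bounded_graph G' B'"
    unfolding bounded_graph_def
  proof (intro conjI allI impI)
    show "(0, 0) \<in> G'" using mem[OF bounded_graphD(1)[OF G], of 0] by simp
  next
    fix x y x' y' assume "(x, y) \<in> G'" "(x', y') \<in> G'"
    then obtain a b c a' b' c' where eq: "x = a + \<phi> c * v" "y = b + c * u" "(a, b) \<in> G"
      "x' = a' + \<phi> c' * v" "y' = b' + c' * u" "(a', b') \<in> G"
      by (auto simp: G'_def)
    have "((a + a') + \<phi> (c + c') * v, (b + b') + (c + c') * u) \<in> G'"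
      using eq by (intro mem bounded_graphD(2)[OF G])
    moreover have "x + x' = (a + a') + \<phi> (c + c') * v" "y + y' = (b + b') + (c + c') * u"
      by (simp_all add: eq hom_add algebra_simps)
    ultimately show "(x + x', y + y') \<in> G'" by simp
  next
    fix k x y assume "(x, y) \<in> G'"
    then obtain a b c where eq: "x = a + \<phi> c * v" "y = b + c * u" "(a, b) \<in> G"
      by (auto simp: G'_def)
    have "(\<phi> k * a + \<phi> (k * c) * v, k * b + (k * c) * u) \<in> G'"
      using eq by (intro mem bounded_graphD(3)[OF G])
    then show "(\<phi> k * x, k * y) \<in> G'"
      by (simp add: eq hom_mult algebra_simps)
  next
    fix x y assume "(x, y) \<in> G'"
    then obtain a b c where eq: "x = a + \<phi> c * v" "y = b + c * u" "(a, b) \<in> G"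
      by (auto simp: G'_def)
    show "na_abs y \<le> B' * na_abs x"
    proof (cases "c = 0")
      case True
      then show ?thesis
        using bounded_graphD(4)[OF G eq(3)] mult_right_mono[of B B' "na_abs a"] B
        by (simp add: eq)
    next
      case False
      have "\<phi> c * \<phi> (inverse c) = 1" using False by (simp flip: hom_mult)
      \<comment> \<open>Dividing by c turns the element into v - w with w in the domain of G, where
        the choice of u applies.\<close>
      then have x: "x = \<phi> c * (v - \<phi> (- inverse c) * a)"
        by (simp add: eq hom_minus algebra_simps flip: mult.assoc)
      have y: "y = c * (u - (- inverse c) * b)"
        using False by (simp add: eq algebra_simps flip: mult.assoc)
      have "na_abs c * na_abs (u - (- inverse c) * b)
          \<le> na_abs c * (B' * na_abs (v - \<phi> (- inverse c) * a))"
        by (intro mult_left_mono u bounded_graphD(3)[OF G eq(3)]) simp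
      then show ?thesis by (simp only: x y na_abs_mult isometric mult.left_commute)
    qed
  qed
  moreover have "G \<subseteq> G'"
    using mem[of _ _ 0] by auto
  moreover have "v \<in> Domain G'"
    using mem[OF bounded_graphD(1)[OF G], of 1] by (auto simp: Domain_iff)
  ultimately show ?thesis by blast
qed

lemma bounded_graph_extend_countable:
  assumes G: "bounded_graph G B" and B: "0 < B" and "countable A"
  shows "\<exists>G'. bounded_graph G' (2 * B) \<and> G \<subseteq> G' \<and> A \<subseteq> Domain G'"
proof -
  \<comment> \<open>0 is inserted because only a nonempty set can be enumerated.\<close>
  define a where "a = from_nat_into (insert 0 A)"
  have a: "A \<subseteq> range a"
    unfolding a_def using assms(3) by (subst range_from_nat_into) auto
  \<comment> \<open>Each new point needs a strictly larger bound; these start at B and stay below 2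
    * B.\<close>
  define C where "C j = B * (2 - (1/2) ^ j)" for j :: nat
  have C: "0 < C j" "C j < C (Suc j)" "C j \<le> 2 * B" for j
  proof -
    have "(1/2::real) ^ j \<le> 1" by (rule power_le_one) auto
    then show "0 < C j" unfolding C_def using B by (intro mult_pos_pos) auto
  qed (use B in \<open>simp_all add: C_def algebra_simps\<close>)
  have "\<exists>H. \<forall>j. (bounded_graph (H j) (C j) \<and> G \<subseteq> H j) \<and> (H j \<subseteq> H (Suc j) \<and> a j \<in> Domain (H (Suc j)))"
  proof (rule dependent_nat_choice)
    show "\<exists>H. bounded_graph H (C 0) \<and> G \<subseteq> H" using G by (auto simp: C_def)
  next
    fix H j assume "bounded_graph H (C j) \<and> G \<subseteq> H"
    then show "\<exists>H'. (bounded_graph H' (C (Suc j)) \<and> G \<subseteq> H') \<and> (H \<subseteq> H' \<and> a j \<in> Domain H')"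
      using bounded_graph_extend_point[OF _ C(1,2)] by (meson order_trans)
  qed
  then obtain H where H: "\<And>j. bounded_graph (H j) (C j)" "G \<subseteq> H 0"
    "\<And>j. H j \<subseteq> H (Suc j)" "\<And>j. a j \<in> Domain (H (Suc j))"
    by blast
  have mono: "H i \<subseteq> H j" if "i \<le> j" for i j
    using H(3) that by (rule lift_Suc_mono_le)
  have "bounded_graph (\<Union>j. H j) (2 * B)"
    unfolding bounded_graph_def
  proof (intro conjI allI impI)
    show "(0, 0) \<in> (\<Union>j. H j)" using bounded_graphD(1)[OF H(1)] by blast
  next
    fix x y x' y' assume "(x, y) \<in> (\<Union>j. H j)" "(x', y') \<in> (\<Union>j. H j)"
    then obtain i j where "(x, y) \<in> H i" "(x', y') \<in> H j" by blast
    then have "(x, y) \<in> H (max i j)" "(x', y') \<in> H (max i j)"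
      using mono[of i "max i j"] mono[of j "max i j"] by auto
    then show "(x + x', y + y') \<in> (\<Union>j. H j)"
      using bounded_graphD(2)[OF H(1)] by blast
  next
    fix k x y assume "(x, y) \<in> (\<Union>j. H j)"
    then show "(\<phi> k * x, k * y) \<in> (\<Union>j. H j)"
      using bounded_graphD(3)[OF H(1)] by blast
  next
    fix x y assume "(x, y) \<in> (\<Union>j. H j)"
    then obtain j where "na_abs y \<le> C j * na_abs x"
      using bounded_graphD(4)[OF H(1)] by blast
    then show "na_abs y \<le> 2 * B * na_abs x"
      using mult_right_mono[OF C(3), of "na_abs x" j] by simp
  qed
  moreover have "x \<in> Domain (\<Union>j. H j)" if "x \<in> A" for x
  proof -
    have "x \<in> range a" using a that by blast
    then obtain j where "x = a j" by blast
    then show ?thesis using H(4)[of j] by blast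
  qed
  moreover have "G \<subseteq> (\<Union>j. H j)" using H(2) by blast
  ultimately show ?thesis by blast
qed

definition functional :: "('c \<times> 'k) set \<Rightarrow> 'c \<Rightarrow> 'k" where
  "functional G x = (THE y. (x, y) \<in> G)"

lemma functional_eq: "bounded_graph G B \<Longrightarrow> (x, y) \<in> G \<Longrightarrow> functional G x = y"
  unfolding functional_def using bounded_graph_unique by blast

lemma functional_mem: "bounded_graph G B \<Longrightarrow> x \<in> Domain G \<Longrightarrow> (x, functional G x) \<in> G"
  using functional_eq by blast

lemma bounded_graph_sum:
  assumes G: "bounded_graph G B" and "\<And>i. i \<in> I \<Longrightarrow> (f i, g i) \<in> G"
  shows "(sum f I, sum g I) \<in> G"
  using assms(2)
  by (induction I rule: infinite_finite_induct)
    (auto simp: bounded_graphD(1)[OF G] intro: bounded_graphD(2)[OF G])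

lemma functional_null_series:
  assumes G: "bounded_graph G B" and "range v \<subseteq> Domain G" "v \<in> null_series X"
  shows "functional G \<circ> v \<in> null_series X"
proof (rule null_series_compose[OF assms(3)])
  show "functional G 0 = 0" by (rule functional_eq[OF G bounded_graphD(1)[OF G]])
  show "na_abs (functional G (v \<nu>)) \<le> B * na_abs (v \<nu>)" for \<nu>
    using assms(2) by (intro bounded_graphD(4)[OF G] functional_mem[OF G]) blast
qed

lemma functional_comp_add:
  assumes G: "bounded_graph G B" and u: "range u \<subseteq> Domain G" and v: "range v \<subseteq> Domain G"
  shows "range (u + v) \<subseteq> Domain G"
    and "functional G \<circ> (u + v) = (functional G \<circ> u) + (functional G \<circ> v)"
proof -
  have mem: "((u + v) \<nu>, functional G (u \<nu>) + functional G (v \<nu>)) \<in> G" for \<nu>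
    unfolding plus_fun_apply
    using u v by (intro bounded_graphD(2)[OF G] functional_mem[OF G]) auto
  show "range (u + v) \<subseteq> Domain G" using mem by blast
  show "functional G \<circ> (u + v) = (functional G \<circ> u) + (functional G \<circ> v)"
    using functional_eq[OF G mem] by auto
qed

text \<open>The second factor has coefficients in k, over which the functional is linear, so it
  passes through the finite sums of the product. This is why functionals take extended submodules
  back to the original ones.\<close>

lemma functional_comp_conv:
  assumes G: "bounded_graph G B" and g: "range g \<subseteq> Domain G"
  shows "range (g \<star> (\<phi> \<circ> f)) \<subseteq> Domain G"
    and "functional G \<circ> (g \<star> (\<phi> \<circ> f)) = (functional G \<circ> g) \<star> f"
proof -
  have "(case p of (\<alpha>, \<beta>) \<Rightarrow> g \<alpha> * (\<phi> \<circ> f) \<beta>, case p of (\<alpha>, \<beta>) \<Rightarrow> (functional G \<circ> g) \<alpha> * f \<beta>) \<in> G" for p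
  proof (cases p)
    case (Pair \<alpha> \<beta>)
    have "(\<phi> (f \<beta>) * g \<alpha>, f \<beta> * functional G (g \<alpha>)) \<in> G"
      using g by (intro bounded_graphD(3)[OF G] functional_mem[OF G]) blast
    then show ?thesis using Pair by (simp add: mult.commute)
  qed
  then have mem: "((g \<star> (\<phi> \<circ> f)) \<nu>, ((functional G \<circ> g) \<star> f) \<nu>) \<in> G" for \<nu>
    unfolding conv_def by (rule bounded_graph_sum[OF G])
  show "range (g \<star> (\<phi> \<circ> f)) \<subseteq> Domain G" using mem by blast
  show "functional G \<circ> (g \<star> (\<phi> \<circ> f)) = (functional G \<circ> g) \<star> f"
    using functional_eq[OF G mem] by auto
qed

lemma functional_comp_sum:
  assumes G: "bounded_graph G B" and "\<And>i. i \<in> I \<Longrightarrow> range (f i) \<subseteq> Domain G"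
  shows "range (sum f I) \<subseteq> Domain G \<and> functional G \<circ> (sum f I) = (\<Sum>i\<in>I. functional G \<circ> f i)"
proof -
  have mem: "(sum f I \<nu>, (\<Sum>i\<in>I. functional G \<circ> f i) \<nu>) \<in> G" for \<nu>
    unfolding sum_fun_apply comp_apply
    using assms(2) by (intro bounded_graph_sum[OF G] functional_mem[OF G]) blast
  then show ?thesis using functional_eq[OF G mem] by fastforce
qed


section \<open>Extension of submodules\<close>

text \<open>The T_n(C)-span of the tuples \<phi> \<circ> f with f in U, where \<open>C\<close> is
  the larger field: the image of U \<otimes> T_n(C) in the tuples over T_n(C).\<close>

inductive_set ext :: "nat \<Rightarrow> 'k mseries set \<Rightarrow> 'c mseries set" for n U where
  zero: "0 \<in> ext n U"
| conv: "g \<in> null_series (exps n) \<Longrightarrow> f \<in> U \<Longrightarrow> g \<star> (\<phi> \<circ> f) \<in> ext n U"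
| add: "x \<in> ext n U \<Longrightarrow> y \<in> ext n U \<Longrightarrow> x + y \<in> ext n U"

lemma ext_mono: "x \<in> ext n U \<Longrightarrow> U \<subseteq> V \<Longrightarrow> x \<in> ext n V"
  by (induction rule: ext.induct) (auto intro: ext.intros)

lemma ext_uminus: "x \<in> ext n U \<Longrightarrow> - x \<in> ext n U"
proof (induction rule: ext.induct)
  case (conv g f)
  then have "(- g) \<star> (\<phi> \<circ> f) \<in> ext n U" by (intro ext.conv null_series_uminus)
  then show ?case by (simp only: conv_minus_left)
next
  case (add x y)
  then have "- x + - y \<in> ext n U" by (intro ext.add)
  then show ?case by (simp only: minus_add_distrib)
qed (simp only: minus_zero ext.zero)

lemma ext_sum: "(\<And>i. i \<in> I \<Longrightarrow> f i \<in> ext n U) \<Longrightarrow> sum f I \<in> ext n U"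
proof (induction I rule: infinite_finite_induct)
  case (insert i I)
  then have "f i + sum f I \<in> ext n U" by (intro ext.add) auto
  then show ?case by (simp only: sum.insert[OF insert.hyps])
qed (simp_all only: sum.infinite sum.empty not_False_eq_True ext.zero)

lemma ext_null_series:
  assumes "series_submodule n m U" "x \<in> ext n U"
  shows "x \<in> null_series (vexps n m)"
  using assms(2)
proof induction
  case (conv g f)
  then have "f \<in> null_series (vexps n m)" using assms(1) by (auto simp: series_submodule_def)
  then show ?case
    using conv by (intro null_series_conv[OF _ null_series_hom] vexps_add)
next
  case (add x y)
  show ?case by (rule null_series_add[OF add.IH])
qed (rule null_series_zero)

text \<open>The set A comes from one presentation of x as a sum of products g \<star> (\<phi>
  \<circ> f): it consists of the coefficients of the series g, and so depends on U and not only on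
  x.\<close>

lemma functional_ext:
  assumes U: "series_submodule n m U" and "x \<in> ext n U"
  shows "\<exists>A. countable A \<and> (\<forall>G B. bounded_graph G B \<longrightarrow> A \<subseteq> Domain G \<longrightarrow>
    range x \<subseteq> Domain G \<and> functional G \<circ> x \<in> U)"
  using assms(2)
proof induction
  case zero
  have *: "range (0 :: 'c mseries) \<subseteq> Domain G \<and> functional G \<circ> 0 \<in> U" if G: "bounded_graph G B" for G B
  proof -
    have mem: "(0 \<nu>, 0 \<nu>) \<in> G" for \<nu> :: "nat \<Rightarrow>\<^sub>0 nat"
      unfolding zero_fun_apply using G by (rule bounded_graphD(1))
    have "functional G \<circ> 0 = 0" using functional_eq[OF G mem] by auto
    moreover have "0 \<in> U" using U unfolding series_submodule_def by blast
    moreover have "range (0 :: 'c mseries) \<subseteq> Domain G" using mem by blast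
    ultimately show ?thesis by metis
  qed
  show ?case
    by (intro exI[of _ "{}"] conjI[OF countable_empty] allI impI) (rule *)
next
  case (conv g f)
  have *: "range (g \<star> (\<phi> \<circ> f)) \<subseteq> Domain G \<and> functional G \<circ> (g \<star> (\<phi> \<circ> f)) \<in> U"
    if G: "bounded_graph G B" and g: "range g \<subseteq> Domain G" for G B
  proof -
    have "(functional G \<circ> g) \<star> f \<in> U"
      by (rule series_submoduleD(4)[OF U functional_null_series[OF G g conv(1)] conv(2)])
    then have "functional G \<circ> (g \<star> (\<phi> \<circ> f)) \<in> U"
      by (simp only: functional_comp_conv(2)[OF G g])
    with functional_comp_conv(1)[OF G g] show ?thesis ..
  qed
  show ?case
    by (intro exI[of _ "range g"] conjI[OF countable_null_series_range[OF conv(1)]] allI impI)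
      (rule *)
next
  case (add x y)
  from add.IH(1) obtain A where A: "countable A \<and> (\<forall>G B. bounded_graph G B \<longrightarrow> A \<subseteq> Domain G \<longrightarrow>
      range x \<subseteq> Domain G \<and> functional G \<circ> x \<in> U)" ..
  from add.IH(2) obtain A' where A': "countable A' \<and> (\<forall>G B. bounded_graph G B \<longrightarrow> A' \<subseteq> Domain G \<longrightarrow>
      range y \<subseteq> Domain G \<and> functional G \<circ> y \<in> U)" ..
  have *: "range (x + y) \<subseteq> Domain G \<and> functional G \<circ> (x + y) \<in> U"
    if G: "bounded_graph G B" and AA': "A \<union> A' \<subseteq> Domain G" for G B
  proof -
    have x: "range x \<subseteq> Domain G" "functional G \<circ> x \<in> U"
      and y: "range y \<subseteq> Domain G" "functional G \<circ> y \<in> U"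
      using A[THEN conjunct2, rule_format, OF G] A'[THEN conjunct2, rule_format, OF G] AA'
      by simp_all
    have "functional G \<circ> (x + y) \<in> U"
      unfolding functional_comp_add(2)[OF G x(1) y(1)]
      by (rule series_submoduleD(3)[OF U x(2) y(2)])
    with functional_comp_add(1)[OF G x(1) y(1)] show ?thesis ..
  qed
  have "countable (A \<union> A')" using A A' by (intro countable_Un) simp_all
  from conjI[OF this] show ?case
    by (rule exI[of _ "A \<union> A'"]) (intro allI impI *)
qed

lemma series_submodule_Inter:
  assumes "\<U> \<noteq> {}" "\<And>U. U \<in> \<U> \<Longrightarrow> series_submodule n m U"
  shows "series_submodule n m (\<Inter>\<U>)"
  using assms unfolding series_submodule_def by blast

lemma ext_Inter:
  assumes ne: "\<U> \<noteq> {}" and sub: "\<And>U. U \<in> \<U> \<Longrightarrow> series_submodule n m U"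
    and y: "\<And>U. U \<in> \<U> \<Longrightarrow> y \<in> ext n U"
  shows "y \<in> ext n (\<Inter>\<U>)"
proof -
  have W: "series_submodule n m (\<Inter>\<U>)"
    by (rule series_submodule_Inter[OF ne sub])
  have "y \<in> null_series (vexps n m)"
    using ne sub y ext_null_series by blast
  obtain B :: "(nat \<Rightarrow>\<^sub>0 nat) set" and F where BF: "finite B" "\<And>b. b \<in> B \<Longrightarrow> F b \<in> \<Inter>\<U>"
    "\<And>v. v \<in> null_series (vexps n m) \<Longrightarrow> \<exists>q r. (\<forall>b\<in>B. q b \<in> null_series (exps n)) \<and>
       r \<in> null_series (vexps n m) \<and> (\<forall>p. \<forall>f\<in>\<Inter>\<U>. leading p f \<longrightarrow> r p = 0) \<and>
       v = (\<Sum>b\<in>B. q b \<star> (\<phi> \<circ> F b)) + r"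
    by (rule submodule_division[OF W], rule that)
  obtain q r where q: "\<And>b. b \<in> B \<Longrightarrow> q b \<in> null_series (exps n)"
    and r: "r \<in> null_series (vexps n m)" "\<And>p f. f \<in> \<Inter>\<U> \<Longrightarrow> leading p f \<Longrightarrow> r p = 0"
    and y_eq: "y = (\<Sum>b\<in>B. q b \<star> (\<phi> \<circ> F b)) + r"
    using BF(3)[OF \<open>y \<in> null_series (vexps n m)\<close>] by blast
  have "r p = 0" for p
  proof (rule ccontr)
    assume e: "r p \<noteq> 0"
    \<comment> \<open>The functional on the line through \<open>r p\<close> with value 1 at
      \<open>r p\<close>.\<close>
    let ?G0 = "{(\<phi> c * r p, c) |c. True}"
    have G0: "bounded_graph ?G0 (1 / na_abs (r p))"
      unfolding bounded_graph_def
      using e by (auto simp: na_abs_eq_0_iff na_abs_mult isometric hom_add hom_mult distrib_right mult.assoc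
          intro!: exI[of _ 0])
    \<comment> \<open>A domain with these coefficients also contains those of y, by the division
      formula.\<close>
    have cnt: "countable (range r \<union> (\<Union>b\<in>B. range (q b)))"
      using countable_null_series_range[OF r(1)] countable_null_series_range[OF q]
      by (simp add: countable_finite[OF BF(1)])
    define K where "K = 2 * (1 / na_abs (r p))"
    have pos: "0 < 1 / na_abs (r p)" and K: "0 < K" using e by (simp_all add: K_def)
    obtain G where G: "bounded_graph G K" "?G0 \<subseteq> G"
      "range r \<union> (\<Union>b\<in>B. range (q b)) \<subseteq> Domain G"
      using bounded_graph_extend_countable[OF G0 pos cnt, folded K_def]
      by (elim exE conjE) (rule that)
    have rG: "range r \<subseteq> Domain G" and qG: "\<And>b. b \<in> B \<Longrightarrow> range (q b) \<subseteq> Domain G"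
      using G(3) by blast+
    let ?\<psi> = "functional G"
    let ?s = "\<Sum>b\<in>B. q b \<star> (\<phi> \<circ> F b)"
    have s: "range ?s \<subseteq> Domain G" "?\<psi> \<circ> ?s = (\<Sum>b\<in>B. (?\<psi> \<circ> q b) \<star> F b)"
    proof -
      have 1: "range (q b \<star> (\<phi> \<circ> F b)) \<subseteq> Domain G"
        and 2: "?\<psi> \<circ> (q b \<star> (\<phi> \<circ> F b)) = (?\<psi> \<circ> q b) \<star> F b" if "b \<in> B" for b
        using functional_comp_conv[OF G(1) qG[OF that]] by blast+
      have *: "range ?s \<subseteq> Domain G \<and> ?\<psi> \<circ> ?s = (\<Sum>b\<in>B. ?\<psi> \<circ> (q b \<star> (\<phi> \<circ> F b)))"
        by (rule functional_comp_sum[OF G(1) 1])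
      then show "range ?s \<subseteq> Domain G" ..
      have "(\<Sum>b\<in>B. ?\<psi> \<circ> (q b \<star> (\<phi> \<circ> F b))) = (\<Sum>b\<in>B. (?\<psi> \<circ> q b) \<star> F b)"
        by (rule sum.cong) (use 2 in blast)+
      with * show "?\<psi> \<circ> ?s = (\<Sum>b\<in>B. (?\<psi> \<circ> q b) \<star> F b)" by (simp only:)
    qed
    have yG: "range y \<subseteq> Domain G" and \<psi>y: "?\<psi> \<circ> y = (?\<psi> \<circ> ?s) + (?\<psi> \<circ> r)"
      unfolding y_eq by (intro functional_comp_add[OF G(1) s(1) rG])+
    \<comment> \<open>The coefficients in a presentation of y over U may lie outside the domain of
      G. For each U the functional is extended over them separately; on y all these extensions agree
      with G.\<close>
    have "?\<psi> \<circ> y \<in> U" if U: "U \<in> \<U>" for U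
    proof -
      obtain A where A: "countable A" "\<And>G B. bounded_graph G B \<Longrightarrow> A \<subseteq> Domain G \<Longrightarrow>
          functional G \<circ> y \<in> U"
        using functional_ext[OF sub[OF U] y[OF U]] by blast
      obtain G' where G': "bounded_graph G' (2 * K)" "G \<subseteq> G'" "A \<subseteq> Domain G'"
        using bounded_graph_extend_countable[OF G(1) K A(1)] by blast
      have "functional G' (y \<nu>) = ?\<psi> (y \<nu>)" for \<nu>
        using functional_mem[OF G(1)] yG G'(2) by (intro functional_eq[OF G'(1)]) blast
      then have "functional G' \<circ> y = ?\<psi> \<circ> y" by auto
      then show ?thesis using A(2)[OF G'(1,3)] by simp
    qed
    then have "?\<psi> \<circ> y \<in> \<Inter>\<U>" by blast
    moreover have "?\<psi> \<circ> ?s \<in> \<Inter>\<U>"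
      unfolding s(2)
    proof (rule series_submodule_sum[OF W])
      fix b assume b: "b \<in> B"
      have "?\<psi> \<circ> q b \<in> null_series (exps n)"
        using functional_null_series[OF G(1) qG[OF b] q[OF b]] .
      then show "(?\<psi> \<circ> q b) \<star> F b \<in> \<Inter>\<U>"
        using W BF(2)[OF b] unfolding series_submodule_def by blast
    qed
    ultimately have "(?\<psi> \<circ> y) - (?\<psi> \<circ> ?s) \<in> \<Inter>\<U>"
      by (rule series_submodule_diff[OF W])
    then have "?\<psi> \<circ> r \<in> \<Inter>\<U>" unfolding \<psi>y add_diff_cancel_left' .
    moreover have "(?\<psi> \<circ> r) p' = 0" if "f \<in> \<Inter>\<U>" "leading p' f" for p' f
      using r(2)[OF that] functional_eq[OF G(1) bounded_graphD(1)[OF G(1)]] by simp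
    ultimately have "?\<psi> \<circ> r = 0"
      by (rule series_submodule_eq_0[OF W])
    then have "?\<psi> (r p) = 0" by (metis comp_apply zero_fun_apply)
    moreover have "(r p, 1) \<in> G" using G(2) hom_one by force
    ultimately show False using functional_eq[OF G(1)] by fastforce
  qed
  then have "r = 0" by auto
  then have "y = (\<Sum>b\<in>B. q b \<star> (\<phi> \<circ> F b))" using y_eq by (simp only: add_0_right)
  then show ?thesis using BF(2) q by (auto intro!: ext_sum ext.conv)
qed

end


section \<open>Tate algebras\<close>

text \<open>Only finitely many exponents in n variables have degree below N, so for series supported
  on them convergence as the degree grows is convergence along the cofinite filter.\<close>

lemma carrier_tate_ring: "carrier (tate_ring n) = null_series (exps n)"
proof -
  have "((\<lambda>\<nu>. na_abs (a \<nu>)) \<longlongrightarrow> 0) (filtercomap (\<lambda>\<nu>. \<Sum>i<n. Poly_Mapping.lookup \<nu> i) at_top)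
      \<longleftrightarrow> (\<forall>e>0. finite {\<nu>. e \<le> na_abs (a \<nu>)})"
    if supp: "\<And>\<nu>. \<nu> \<notin> exps n \<Longrightarrow> a \<nu> = 0" for a :: "'a mseries"
  proof -
    let ?deg = "\<lambda>\<nu>. \<Sum>i<n. Poly_Mapping.lookup \<nu> i"
    have fin: "finite {\<nu> \<in> exps n. ?deg \<nu> < N}" for N
    proof -
      let ?F = "{f. \<forall>x. (x \<in> {..<n} \<longrightarrow> f x \<in> {..<N}) \<and> (x \<notin> {..<n} \<longrightarrow> f x = (0::nat))}"
      have "Poly_Mapping.lookup ` {\<nu> \<in> exps n. ?deg \<nu> < N} \<subseteq> ?F"
      proof safe
        fix \<nu> i assume "\<nu> \<in> exps n" "?deg \<nu> < N" "i < n"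
        then show "Poly_Mapping.lookup \<nu> i < N"
          using member_le_sum[of i "{..<n}" "Poly_Mapping.lookup \<nu>"] by simp
      qed (rule ccontr, simp add: lookup_exps_0)
      moreover have "finite ?F" by (rule finite_set_of_finite_funs) auto
      ultimately show ?thesis
        by (rule inj_on_finite[rotated]) (simp add: inj_on_def)
    qed
    have "(\<exists>N. \<forall>\<nu>. N \<le> ?deg \<nu> \<longrightarrow> na_abs (a \<nu>) < e) \<longleftrightarrow> finite {\<nu>. e \<le> na_abs (a \<nu>)}"
      if e: "e > 0" for e
    proof
      assume "\<exists>N. \<forall>\<nu>. N \<le> ?deg \<nu> \<longrightarrow> na_abs (a \<nu>) < e"
      then obtain N where N: "\<And>\<nu>. N \<le> ?deg \<nu> \<Longrightarrow> na_abs (a \<nu>) < e" by blast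
      have "{\<nu>. e \<le> na_abs (a \<nu>)} \<subseteq> {\<nu> \<in> exps n. ?deg \<nu> < N}"
      proof safe
        fix \<nu> assume \<nu>: "e \<le> na_abs (a \<nu>)"
        then have "\<not> N \<le> ?deg \<nu>" using N[of \<nu>] by auto
        then show "?deg \<nu> < N" by simp
        show "\<nu> \<in> exps n" using \<nu> e supp[of \<nu>] by force
      qed
      then show "finite {\<nu>. e \<le> na_abs (a \<nu>)}" using fin finite_subset by blast
    next
      assume F: "finite {\<nu>. e \<le> na_abs (a \<nu>)}"
      \<comment> \<open>The total degree of the finitely many exponents with large coefficient
        exceeds none of their degrees from below, so its successor is a threshold beyond all of
        them.\<close>
      have "na_abs (a \<nu>) < e" if "Suc (\<Sum>\<mu> | e \<le> na_abs (a \<mu>). ?deg \<mu>) \<le> ?deg \<nu>" for \<nu>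
      proof (rule ccontr)
        assume "\<not> ?thesis"
        then have "?deg \<nu> \<le> (\<Sum>\<mu> | e \<le> na_abs (a \<mu>). ?deg \<mu>)"
          using F by (intro member_le_sum) auto
        then show False using that by simp
      qed
      then show "\<exists>N. \<forall>\<nu>. N \<le> ?deg \<nu> \<longrightarrow> na_abs (a \<nu>) < e" by blast
    qed
    then show ?thesis
      by (simp add: tendsto_iff eventually_filtercomap_at_top_linorder)
  qed
  then show ?thesis
    by (auto simp: tate_ring_def power_series_ring_def null_series_def exps_def)
qed

lemma tate_ring_simps:
  "a \<otimes>\<^bsub>tate_ring n\<^esub> b = a \<star> b" "a \<oplus>\<^bsub>tate_ring n\<^esub> b = a + b"
  "\<one>\<^bsub>tate_ring n\<^esub> = monomial 1 0" "\<zero>\<^bsub>tate_ring n\<^esub> = 0"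
  by (auto simp: tate_ring_def power_series_ring_def conv_def monomial_def fun_eq_iff)

lemma tate_algebra_simps:
  "carrier (tate_algebra n \<phi>) = null_series (exps n)"
  "a \<otimes>\<^bsub>tate_algebra n \<phi>\<^esub> b = a \<star> b" "a \<oplus>\<^bsub>tate_algebra n \<phi>\<^esub> b = a + b"
  "\<one>\<^bsub>tate_algebra n \<phi>\<^esub> = monomial 1 0" "\<zero>\<^bsub>tate_algebra n \<phi>\<^esub> = 0"
  "c \<odot>\<^bsub>tate_algebra n \<phi>\<^esub> a = (\<phi> \<circ> c) \<star> a"
  by (simp_all only: tate_algebra_def partial_object.simps monoid.simps ring.simps module.simps
      carrier_tate_ring tate_ring_simps)

lemma null_series_exps_conv:
  "a \<in> null_series (exps n) \<Longrightarrow> b \<in> null_series (exps n) \<Longrightarrow> a \<star> b \<in> null_series (exps n)"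
  by (rule null_series_conv[OF _ _ exps_add])

text \<open>An arbitrary record R covers both \<open>tate_ring n\<close> and the ring underlying
  \<open>tate_algebra n \<phi>\<close>.\<close>

lemma cring_null_series:
  fixes R :: "('k::na_field mseries, 'z) ring_scheme"
  assumes "carrier R = null_series (exps n)"
    "\<And>a b. a \<otimes>\<^bsub>R\<^esub> b = a \<star> b" "\<And>a b. a \<oplus>\<^bsub>R\<^esub> b = a + b"
    "\<one>\<^bsub>R\<^esub> = monomial 1 0" "\<zero>\<^bsub>R\<^esub> = 0"
  shows "cring R"
proof (rule cringI)
  show "abelian_group R"
  proof (rule abelian_groupI, unfold assms)
    fix x :: "'k mseries" assume "x \<in> null_series (exps n)"
    then show "\<exists>y\<in>null_series (exps n). y + x = 0"
      by (intro bexI[of _ "- x"] null_series_uminus) (simp_all only: ab_left_minus)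
  qed (simp_all only: null_series_add null_series_zero ac_simps add_0_left add_0_right)
  show "comm_monoid R"
    by (rule comm_monoidI, unfold assms)
      (simp_all only: null_series_exps_conv null_series_monomial zero_in_exps conv_assoc one_conv,
        rule conv_commute)
qed (simp only: assms conv_add_left)

lemma cring_tate_ring: "cring (tate_ring n)"
  by (rule cring_null_series[where n = n]) (simp_all only: carrier_tate_ring tate_ring_simps)

lemma (in na_embedding) algebra_tate: "algebra (tate_ring n) (tate_algebra n \<phi>)"
proof (rule algebraI)
  show "cring (tate_ring n :: 'k mseries ring)" by (rule cring_tate_ring)
  show "cring (tate_algebra n \<phi>)"
    by (rule cring_null_series[where n = n]) (simp_all only: tate_algebra_simps)
qed (simp_all only: carrier_tate_ring tate_ring_simps tate_algebra_simps null_series_hom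
    null_series_exps_conv hom_comp_add hom_comp_conv hom_comp_monomial hom_one conv_add_left
    conv_add_right conv_assoc one_conv)


section \<open>Components of vectors\<close>

definition component :: "nat \<Rightarrow> nat \<Rightarrow> 'k::field mseries \<Rightarrow> 'k mseries" where
  "component n j v = (\<lambda>\<nu>. if \<nu> \<in> exps n then v (\<nu> + Poly_Mapping.single n j) else 0)"

lemma component_add: "component n j (u + v) = component n j u + component n j v"
  by (simp add: component_def fun_eq_iff)

lemma component_zero [simp]: "component n j 0 = 0"
  by (simp add: component_def fun_eq_iff)

lemma (in na_embedding) component_hom: "component n j (\<phi> \<circ> v) = \<phi> \<circ> component n j v"
  by (simp add: component_def fun_eq_iff)

lemma null_series_component:
  assumes "v \<in> null_series X"
  shows "component n j v \<in> null_series (exps n)"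
proof -
  have "finite {\<nu>. e \<le> na_abs (component n j v \<nu>)}" if "e > 0" for e
  proof -
    have "(\<lambda>\<nu>. \<nu> + Poly_Mapping.single n j) ` {\<nu>. e \<le> na_abs (component n j v \<nu>)}
        \<subseteq> {p. e \<le> na_abs (v p)}"
      using that by (auto simp: component_def split: if_splits)
    moreover have "finite {p. e \<le> na_abs (v p)}"
      using null_seriesD(2)[OF assms that] .
    ultimately show ?thesis
      by (rule inj_on_finite[rotated]) (simp add: inj_on_def)
  qed
  then show ?thesis by (simp add: null_series_def component_def)
qed

text \<open>A factor \<alpha> in \<open>exps n\<close> does not involve variable n, so in a
  decomposition of \<nu> + \<open>?e\<close> the whole of \<open>?e\<close> belongs to the other
  summand.\<close>

lemma component_conv:
  assumes a: "\<And>\<alpha>. \<alpha> \<notin> exps n \<Longrightarrow> a \<alpha> = 0"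
  shows "component n j (a \<star> v) = a \<star> component n j v"
proof
  fix \<nu>
  let ?e = "Poly_Mapping.single n j"
  show "component n j (a \<star> v) \<nu> = (a \<star> component n j v) \<nu>"
  proof (cases "\<nu> \<in> exps n")
    case False
    then have "(a \<star> component n j v) \<nu> = 0"
      using a exps_add by (intro conv_eq_0) (auto simp: component_def)
    then show ?thesis using False by (simp add: component_def)
  next
    case True
    have split: "\<exists>\<gamma>\<in>exps n. \<beta> = \<gamma> + ?e" if "\<alpha> + \<beta> = \<nu> + ?e" "\<alpha> \<in> exps n" for \<alpha> \<beta>
    proof -
      have *: "Poly_Mapping.lookup \<alpha> i + Poly_Mapping.lookup \<beta> i
          = Poly_Mapping.lookup \<nu> i + Poly_Mapping.lookup ?e i" for i
        using that(1) by (metis lookup_add)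
      have eq: "Poly_Mapping.lookup \<beta> i = Poly_Mapping.lookup ?e i" if "n \<le> i" for i
        using *[of i] lookup_exps_0[OF True that] lookup_exps_0[OF \<open>\<alpha> \<in> exps n\<close> that] by simp
      have "\<beta> = (\<beta> - ?e) + ?e"
        using eq by (intro poly_mapping_eqI) (auto simp: lookup_add lookup_minus lookup_single when_def)
      moreover have "\<beta> - ?e \<in> exps n"
        using eq by (intro expsI) (simp add: lookup_minus)
      ultimately show ?thesis by blast
    qed
    have in_exps: "\<alpha> \<in> exps n \<and> \<gamma> \<in> exps n" if "\<alpha> + \<gamma> = \<nu>" for \<alpha> \<gamma>
    proof -
      have "Poly_Mapping.lookup \<alpha> i + Poly_Mapping.lookup \<gamma> i = 0" if "n \<le> i" for i
        using lookup_exps_0[OF True that] \<open>\<alpha> + \<gamma> = \<nu>\<close> by (metis lookup_add)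
      then show ?thesis by (auto intro!: expsI)
    qed
    have "(a \<star> component n j v) \<nu> = (\<Sum>(\<alpha>, \<gamma>) | \<alpha> + \<gamma> = \<nu>. a \<alpha> * v (\<gamma> + ?e))"
      unfolding conv_def using in_exps by (intro sum.cong) (auto simp: component_def)
    also have "\<dots> = (\<Sum>(\<alpha>, \<beta>) \<in> (\<lambda>(\<alpha>, \<gamma>). (\<alpha>, \<gamma> + ?e)) ` {(\<alpha>, \<gamma>). \<alpha> + \<gamma> = \<nu>}. a \<alpha> * v \<beta>)"
      by (subst sum.reindex) (auto simp: inj_on_def case_prod_unfold)
    also have "\<dots> = (\<Sum>(\<alpha>, \<beta>) | \<alpha> + \<beta> = \<nu> + ?e. a \<alpha> * v \<beta>)"
    proof (rule sum.mono_neutral_left[OF finite_decompositions])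
      show "(\<lambda>(\<alpha>, \<gamma>). (\<alpha>, \<gamma> + ?e)) ` {(\<alpha>, \<gamma>). \<alpha> + \<gamma> = \<nu>} \<subseteq> {(\<alpha>, \<beta>). \<alpha> + \<beta> = \<nu> + ?e}"
        by (auto simp: add.assoc)
      show "\<forall>p\<in>{(\<alpha>, \<beta>). \<alpha> + \<beta> = \<nu> + ?e} - (\<lambda>(\<alpha>, \<gamma>). (\<alpha>, \<gamma> + ?e)) ` {(\<alpha>, \<gamma>). \<alpha> + \<gamma> = \<nu>}.
          (case p of (\<alpha>, \<beta>) \<Rightarrow> a \<alpha> * v \<beta>) = 0"
      proof safe
        fix \<alpha> \<beta> assume \<alpha>\<beta>: "\<alpha> + \<beta> = \<nu> + ?e"
          and notin: "(\<alpha>, \<beta>) \<notin> (\<lambda>(\<alpha>, \<gamma>). (\<alpha>, \<gamma> + ?e)) ` {(\<alpha>, \<gamma>). \<alpha> + \<gamma> = \<nu>}"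
        have "\<alpha> \<notin> exps n"
        proof
          assume "\<alpha> \<in> exps n"
          then obtain \<gamma> where \<gamma>: "\<beta> = \<gamma> + ?e" using split[OF \<alpha>\<beta>] by blast
          then have "\<alpha> + \<gamma> = \<nu>" using \<alpha>\<beta> by (simp flip: add.assoc)
          then show False using notin \<gamma> by force
        qed
        then show "a \<alpha> * v \<beta> = 0" by (simp add: a)
      qed
    qed
    finally show ?thesis using True by (simp add: component_def conv_def)
  qed
qed

lemma single_in_vexps: "j < m \<Longrightarrow> Poly_Mapping.single n j \<in> vexps n m"
  by (auto simp: vexps_def lookup_single when_def intro!: expsI)

lemma component_unit:
  "component n i (monomial c (Poly_Mapping.single n j)) = (if i = j then monomial c 0 else 0)"
proof
  fix \<nu>
  have "\<nu> + Poly_Mapping.single n i = Poly_Mapping.single n j \<longleftrightarrow> i = j \<and> \<nu> = 0" if "\<nu> \<in> exps n"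
  proof
    assume eq: "\<nu> + Poly_Mapping.single n i = Poly_Mapping.single n j"
    have "Poly_Mapping.lookup \<nu> n + Poly_Mapping.lookup (Poly_Mapping.single n i) n
        = Poly_Mapping.lookup (Poly_Mapping.single n j) n"
      unfolding eq[symmetric] by (simp only: lookup_add)
    then have "i = j" using lookup_exps_0[OF that order_refl] by simp
    then show "i = j \<and> \<nu> = 0" using eq by simp
  qed simp
  then show "component n i (monomial c (Poly_Mapping.single n j)) \<nu>
      = (if i = j then monomial c 0 else 0) \<nu>"
    by (auto simp: component_def monomial_def)
qed


section \<open>Presentations of finitely generated modules\<close>

lemma null_series_vexps_conv:
  "a \<in> null_series (exps n) \<Longrightarrow> b \<in> null_series (vexps n m) \<Longrightarrow> a \<star> b \<in> null_series (vexps n m)"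
  by (rule null_series_conv[OF _ _ vexps_add])

locale presented_module = na_embedding \<phi> + L: module "tate_ring n" L
  for \<phi> :: "'k::na_field \<Rightarrow> 'c::na_field" and n :: nat and L :: "('k mseries, 'l) module" +
  fixes m :: nat and s :: "nat \<Rightarrow> 'l"
  assumes s_closed: "j < m \<Longrightarrow> s j \<in> carrier L"
    and generates: "submodule N (tate_ring n) L \<Longrightarrow> s ` {..<m} \<subseteq> N \<Longrightarrow> N = carrier L"
begin

abbreviation "V \<equiv> (null_series (vexps n m) :: 'k mseries set)"

definition proj :: "'k mseries \<Rightarrow> 'l" where
  "proj v = (\<Oplus>\<^bsub>L\<^esub>j\<in>{..<m}. component n j v \<odot>\<^bsub>L\<^esub> s j)"

lemma component_closed: "v \<in> V \<Longrightarrow> component n j v \<in> carrier (tate_ring n)"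
  unfolding carrier_tate_ring by (rule null_series_component)

lemma summand_closed: "v \<in> V \<Longrightarrow> (\<lambda>j. component n j v \<odot>\<^bsub>L\<^esub> s j) \<in> {..<m} \<rightarrow> carrier L"
  by (intro Pi_I L.smult_closed component_closed s_closed) simp_all

lemma proj_closed: "v \<in> V \<Longrightarrow> proj v \<in> carrier L"
  unfolding proj_def by (intro L.finsum_closed summand_closed)

lemma proj_add:
  assumes "u \<in> V" "v \<in> V"
  shows "proj (u + v) = proj u \<oplus>\<^bsub>L\<^esub> proj v"
proof -
  have "component n j (u + v) \<odot>\<^bsub>L\<^esub> s j
      = component n j u \<odot>\<^bsub>L\<^esub> s j \<oplus>\<^bsub>L\<^esub> component n j v \<odot>\<^bsub>L\<^esub> s j" if "j < m" for j
    using L.smult_l_distr[OF component_closed[OF assms(1)] component_closed[OF assms(2)] s_closed[OF that]]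
    unfolding component_add tate_ring_simps .
  then have "proj (u + v)
      = (\<Oplus>\<^bsub>L\<^esub>j\<in>{..<m}. component n j u \<odot>\<^bsub>L\<^esub> s j \<oplus>\<^bsub>L\<^esub> component n j v \<odot>\<^bsub>L\<^esub> s j)"
    unfolding proj_def using summand_closed[OF assms(1)] summand_closed[OF assms(2)]
    by (intro L.finsum_cong') auto
  also have "\<dots> = proj u \<oplus>\<^bsub>L\<^esub> proj v"
    unfolding proj_def using summand_closed assms by (intro L.finsum_addf)
  finally show ?thesis .
qed

lemma proj_conv:
  assumes a: "a \<in> null_series (exps n)" and v: "v \<in> V"
  shows "proj (a \<star> v) = a \<odot>\<^bsub>L\<^esub> proj v"
proof -
  have a': "a \<in> carrier (tate_ring n)" unfolding carrier_tate_ring by (rule a)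
  have "component n j (a \<star> v) = a \<star> component n j v" for j
    by (rule component_conv) (rule null_seriesD(1)[OF a])
  then have "component n j (a \<star> v) \<odot>\<^bsub>L\<^esub> s j = a \<odot>\<^bsub>L\<^esub> (component n j v \<odot>\<^bsub>L\<^esub> s j)" if "j < m" for j
    using L.smult_assoc1[OF a' component_closed[OF v, of j] s_closed[OF that]]
    by (simp only: tate_ring_simps)
  then have "proj (a \<star> v) = (\<Oplus>\<^bsub>L\<^esub>j\<in>{..<m}. a \<odot>\<^bsub>L\<^esub> (component n j v \<odot>\<^bsub>L\<^esub> s j))"
    unfolding proj_def using summand_closed[OF v] a'
    by (intro L.finsum_cong') auto
  also have "\<dots> = a \<odot>\<^bsub>L\<^esub> proj v"
    unfolding proj_def using L.finsum_smult_ldistr[OF _ a' summand_closed[OF v]] by simp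
  finally show ?thesis .
qed

lemma proj_unit:
  assumes "j < m"
  shows "proj (monomial 1 (Poly_Mapping.single n j)) = s j"
proof -
  have "component n i (monomial 1 (Poly_Mapping.single n j)) \<odot>\<^bsub>L\<^esub> s i
      = (if j = i then s i else \<zero>\<^bsub>L\<^esub>)" if "i < m" for i
    using L.smult_one[OF s_closed[OF that]] L.smult_l_null[OF s_closed[OF that]]
    unfolding component_unit tate_ring_simps by (cases "i = j") (simp_all only: eq_commute[of j i] if_True if_False refl)
  then have "proj (monomial 1 (Poly_Mapping.single n j))
      = (\<Oplus>\<^bsub>L\<^esub>i\<in>{..<m}. if j = i then s i else \<zero>\<^bsub>L\<^esub>)"
    unfolding proj_def using s_closed by (intro L.finsum_cong') auto
  also have "\<dots> = s j"
    using assms s_closed by (intro L.finsum_singleton) auto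
  finally show ?thesis .
qed

lemma proj_zero: "proj 0 = \<zero>\<^bsub>L\<^esub>"
proof -
  have "proj 0 \<oplus>\<^bsub>L\<^esub> proj 0 = proj 0"
    using proj_add[of 0 0] by (simp only: null_series_zero add_0_left)
  then show ?thesis using proj_closed[OF null_series_zero] by simp
qed

lemma proj_uminus:
  assumes "v \<in> V"
  shows "proj (- v) = \<ominus>\<^bsub>L\<^esub> proj v"
proof -
  have "proj (- v) \<oplus>\<^bsub>L\<^esub> proj v = \<zero>\<^bsub>L\<^esub>"
    using proj_add[OF null_series_uminus[OF assms] assms] unfolding ab_left_minus proj_zero by simp
  then show ?thesis
    using proj_closed assms null_series_uminus by (metis L.minus_equality)
qed

lemma proj_surj: "proj ` V = carrier L"
proof (rule generates)
  show "submodule (proj ` V) (tate_ring n) L"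
  proof (rule L.submoduleI)
    show "proj ` V \<subseteq> carrier L" using proj_closed by blast
    show "\<zero>\<^bsub>L\<^esub> \<in> proj ` V" unfolding proj_zero[symmetric] by (rule imageI[OF null_series_zero])
    show "\<ominus>\<^bsub>L\<^esub> x \<in> proj ` V" if "x \<in> proj ` V" for x
      using that by (elim imageE) (simp only: proj_uminus[symmetric] null_series_uminus imageI)
    show "x \<oplus>\<^bsub>L\<^esub> y \<in> proj ` V" if "x \<in> proj ` V" "y \<in> proj ` V" for x y
      using that by (elim imageE) (simp only: proj_add[symmetric] null_series_add imageI)
    show "a \<odot>\<^bsub>L\<^esub> x \<in> proj ` V" if "a \<in> carrier (tate_ring n)" "x \<in> proj ` V" for a x
      using that unfolding carrier_tate_ring
      by (elim imageE) (simp only: proj_conv[symmetric] null_series_vexps_conv imageI)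
  qed
  show "s ` {..<m} \<subseteq> proj ` V"
  proof safe
    fix j assume "j < m"
    then have "proj (monomial 1 (Poly_Mapping.single n j)) \<in> proj ` V"
      by (intro imageI null_series_monomial single_in_vexps)
    then show "s j \<in> proj ` V" unfolding proj_unit[OF \<open>j < m\<close>] .
  qed
qed

definition preimage :: "'l set \<Rightarrow> 'k mseries set" where
  "preimage U = {v \<in> V. proj v \<in> U}"

lemma submodule_closed:
  assumes "submodule U (tate_ring n) L"
  shows "U \<subseteq> carrier L" "\<zero>\<^bsub>L\<^esub> \<in> U" "x \<in> U \<Longrightarrow> y \<in> U \<Longrightarrow> x \<oplus>\<^bsub>L\<^esub> y \<in> U"
    "a \<in> carrier (tate_ring n) \<Longrightarrow> x \<in> U \<Longrightarrow> a \<odot>\<^bsub>L\<^esub> x \<in> U"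
proof -
  interpret submodule U "tate_ring n" L by fact
  show "U \<subseteq> carrier L" "x \<in> U \<Longrightarrow> y \<in> U \<Longrightarrow> x \<oplus>\<^bsub>L\<^esub> y \<in> U" "\<zero>\<^bsub>L\<^esub> \<in> U"
    using subset m_closed one_closed by auto
  show "a \<in> carrier (tate_ring n) \<Longrightarrow> x \<in> U \<Longrightarrow> a \<odot>\<^bsub>L\<^esub> x \<in> U"
    by (rule smult_closed)
qed

lemma series_submodule_preimage:
  assumes U: "submodule U (tate_ring n) L"
  shows "series_submodule n m (preimage U)"
  unfolding series_submodule_def preimage_def
proof (intro conjI ballI CollectI subsetI; (elim CollectE conjE)?)
  show "proj 0 \<in> U" unfolding proj_zero by (rule submodule_closed(2)[OF U])
next
  fix f g assume "f \<in> V" "proj f \<in> U" "g \<in> V" "proj g \<in> U"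
  then show "f + g \<in> V" "proj (f + g) \<in> U"
    using submodule_closed(3)[OF U] proj_add null_series_add by metis+
next
  fix a f :: "'k mseries" assume a: "a \<in> null_series (exps n)" and "f \<in> V" "proj f \<in> U"
  then show "a \<star> f \<in> V" "proj (a \<star> f) \<in> U"
    using submodule_closed(4)[OF U] null_series_vexps_conv proj_conv[OF a]
    unfolding carrier_tate_ring by metis+
qed (assumption | rule null_series_zero)+

text \<open>A section of \<open>proj\<close> chosen pointwise, without linearity; its failures to be
  linear lie in the kernel of \<open>proj\<close>.\<close>

definition lift :: "'l \<Rightarrow> 'k mseries" where
  "lift x = (SOME v. v \<in> V \<and> proj v = x)"

lemma lift: "x \<in> carrier L \<Longrightarrow> lift x \<in> V" "x \<in> carrier L \<Longrightarrow> proj (lift x) = x"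
proof -
  have "lift x \<in> V \<and> proj (lift x) = x" if "x \<in> carrier L" for x
  proof -
    from that[folded proj_surj] obtain v where "x = proj v" "v \<in> V" by (elim imageE)
    then have "\<exists>v. v \<in> V \<and> proj v = x" by (intro exI[of _ v]) simp
    then show ?thesis unfolding lift_def by (rule someI_ex)
  qed
  then show "x \<in> carrier L \<Longrightarrow> lift x \<in> V" "x \<in> carrier L \<Longrightarrow> proj (lift x) = x" by blast+
qed

lemma lift_preimage: "U \<subseteq> carrier L \<Longrightarrow> x \<in> U \<Longrightarrow> lift x \<in> preimage U"
  by (simp add: preimage_def lift subset_iff)

end


section \<open>Tensor products\<close>

definition tensor_gens ::
  "('r, 'w) ring_scheme \<Rightarrow> ('r, 'l, 'y) module_scheme \<Rightarrow> ('r, 'm, 'z) module_scheme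
     \<Rightarrow> ('l \<times> 'm \<Rightarrow>\<^sub>0 int) set" where
  "tensor_gens R L M =
     {frag_of (x \<oplus>\<^bsub>L\<^esub> x', m) - frag_of (x, m) - frag_of (x', m) | x x' m.
         x \<in> carrier L \<and> x' \<in> carrier L \<and> m \<in> carrier M} \<union>
      {frag_of (x, m \<oplus>\<^bsub>M\<^esub> m') - frag_of (x, m) - frag_of (x, m') | x m m'.
         x \<in> carrier L \<and> m \<in> carrier M \<and> m' \<in> carrier M} \<union>
      {frag_of (r \<odot>\<^bsub>L\<^esub> x, m) - frag_of (x, r \<odot>\<^bsub>M\<^esub> m) | r x m.
         r \<in> carrier R \<and> x \<in> carrier L \<and> m \<in> carrier M}"

lemma tensor_rels_eq:
  "tensor_rels R L M = generate (free_Abelian_group (carrier L \<times> carrier M)) (tensor_gens R L M)"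
  by (simp only: tensor_rels_def tensor_gens_def)

lemma tensor_gensE:
  assumes "h \<in> tensor_gens R L M"
  obtains (left) x x' m where "x \<in> carrier L" "x' \<in> carrier L" "m \<in> carrier M"
      "h = frag_of (x \<oplus>\<^bsub>L\<^esub> x', m) - frag_of (x, m) - frag_of (x', m)"
    | (right) x m m' where "x \<in> carrier L" "m \<in> carrier M" "m' \<in> carrier M"
      "h = frag_of (x, m \<oplus>\<^bsub>M\<^esub> m') - frag_of (x, m) - frag_of (x, m')"
    | (scale) r x m where "r \<in> carrier R" "x \<in> carrier L" "m \<in> carrier M"
      "h = frag_of (r \<odot>\<^bsub>L\<^esub> x, m) - frag_of (x, r \<odot>\<^bsub>M\<^esub> m)"
  using assms unfolding tensor_gens_def by blast

lemma keys_diff_subset: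
  "Poly_Mapping.keys a \<subseteq> S \<Longrightarrow> Poly_Mapping.keys b \<subseteq> S \<Longrightarrow> Poly_Mapping.keys (a - b) \<subseteq> S"
  using keys_diff[of a b] by blast

lemma keys_add_subset:
  "Poly_Mapping.keys a \<subseteq> S \<Longrightarrow> Poly_Mapping.keys b \<subseteq> S \<Longrightarrow> Poly_Mapping.keys (a + b) \<subseteq> S"
  using Poly_Mapping.keys_add[of a b] by blast

lemma keys_tensor_gens:
  assumes "module R L" "module R M" and h: "h \<in> tensor_gens R L M"
  shows "Poly_Mapping.keys h \<subseteq> carrier L \<times> carrier M"
proof -
  interpret L: module R L by fact
  interpret M: module R M by fact
  show ?thesis
    using h
  proof (cases rule: tensor_gensE)
    case left
    then show ?thesis unfolding left(4) by (intro keys_diff_subset) simp_all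
  next
    case right
    then show ?thesis unfolding right(4) by (intro keys_diff_subset) simp_all
  next
    case scale
    then show ?thesis unfolding scale(4) by (intro keys_diff_subset) simp_all
  qed
qed

lemma inv_free_Abelian_gen:
  assumes "module R L" "module R M" "h \<in> tensor_gens R L M"
  shows "inv\<^bsub>free_Abelian_group (carrier L \<times> carrier M)\<^esub> h = - h"
  by (rule inv_free_Abelian_group[OF keys_tensor_gens[OF assms]])

text \<open>Inversion in the free abelian group is negation for elements supported on its basis, as
  the generators are; this turns the inverse rule of \<open>generate\<close> into the case
  \<open>neg\<close>.\<close>

lemma tensor_rels_induct [consumes 3, case_names zero gen neg add]:
  assumes R: "module R L" "module R M" and c: "c \<in> tensor_rels R L M"
    and "P 0" "\<And>h. h \<in> tensor_gens R L M \<Longrightarrow> P h" "\<And>h. h \<in> tensor_gens R L M \<Longrightarrow> P (- h)"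
    "\<And>a b. P a \<Longrightarrow> P b \<Longrightarrow> P (a + b)"
  shows "P c"
  using c unfolding tensor_rels_eq
  by (induction rule: generate.induct) (simp_all only: one_free_Abelian_group
      mult_free_Abelian_group inv_free_Abelian_gen[OF R] assms(4-))

lemma tensor_rels_closed:
  assumes R: "module R L" "module R M"
  shows "0 \<in> tensor_rels R L M" "h \<in> tensor_gens R L M \<Longrightarrow> h \<in> tensor_rels R L M"
    "a \<in> tensor_rels R L M \<Longrightarrow> b \<in> tensor_rels R L M \<Longrightarrow> a + b \<in> tensor_rels R L M"
    "a \<in> tensor_rels R L M \<Longrightarrow> - a \<in> tensor_rels R L M"
proof -
  let ?N = "tensor_rels R L M"
  show zero: "0 \<in> ?N"
    unfolding tensor_rels_eq by (metis generate.one one_free_Abelian_group)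
  show gens: "h \<in> tensor_gens R L M \<Longrightarrow> h \<in> ?N" for h
    unfolding tensor_rels_eq by (rule generate.incl)
  show plus: "a \<in> ?N \<Longrightarrow> b \<in> ?N \<Longrightarrow> a + b \<in> ?N" for a b
    unfolding tensor_rels_eq by (metis generate.eng mult_free_Abelian_group)
  assume "a \<in> ?N"
  with R show "- a \<in> ?N"
  proof (induction rule: tensor_rels_induct)
    case (gen h)
    show ?case
      unfolding tensor_rels_eq
      by (subst inv_free_Abelian_gen[OF R gen, symmetric]) (rule generate.inv[OF gen])
  next
    case (neg h)
    then show ?case using gens by (simp only: minus_minus)
  next
    case (add a b)
    from plus[OF add.IH] show ?case by (simp only: minus_add_distrib)
  qed (simp only: minus_zero zero)
qed

lemma tensor_rels_diff:
  assumes "module R L" "module R M" "a \<in> tensor_rels R L M" "b \<in> tensor_rels R L M"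
  shows "a - b \<in> tensor_rels R L M"
  using tensor_rels_closed(3,4)[OF assms(1,2)] assms(3,4) by (metis diff_conv_add_uminus)

lemma tensor_rels_sum:
  assumes "module R L" "module R M" "\<And>i. i \<in> I \<Longrightarrow> f i \<in> tensor_rels R L M"
  shows "sum f I \<in> tensor_rels R L M"
  using assms(3)
  by (induction I rule: infinite_finite_induct)
    (simp_all add: tensor_rels_closed(1,3)[OF assms(1,2)])

lemma tensor_rels_submodule:
  assumes "module R L" "module R M" and U: "submodule U R L"
  shows "tensor_rels R (L\<lparr>carrier := U\<rparr>) M \<subseteq> tensor_rels R L M"
proof
  have subset: "U \<subseteq> carrier L" using module.submoduleE(1)[OF assms(1) U] .
  have gens: "tensor_gens R (L\<lparr>carrier := U\<rparr>) M \<subseteq> tensor_gens R L M"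
    unfolding tensor_gens_def using subset by (intro Un_mono) auto
  fix c assume "c \<in> tensor_rels R (L\<lparr>carrier := U\<rparr>) M"
  with submodule.submodule_is_module[OF U assms(1)] assms(2) show "c \<in> tensor_rels R L M"
  proof (induction rule: tensor_rels_induct)
    case (gen h)
    then show ?case using gens tensor_rels_closed(2)[OF assms(1,2)] by blast
  next
    case (neg h)
    then show ?case using gens tensor_rels_closed(2,4)[OF assms(1,2)] by blast
  qed (rule tensor_rels_closed[OF assms(1,2)]; assumption)+
qed

text \<open>The relations over U are absorbed by those over L. Membership in the image thus means
  having a representative supported on U \<times> M.\<close>

lemma tensor_image_eq:
  assumes R: "module R L" "module R M" and U: "submodule U R L"
  shows "tensor_image R L U M =
    (\<lambda>c. (\<lambda>h. h + c) ` tensor_rels R L M) ` {c. Poly_Mapping.keys c \<subseteq> U \<times> carrier M}"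
proof -
  let ?N = "tensor_rels R L M" and ?N' = "tensor_rels R (L\<lparr>carrier := U\<rparr>) M"
  have N': "0 \<in> ?N'"
    using tensor_rels_closed(1)[OF submodule.submodule_is_module[OF U R(1)] R(2)] .
  have carrier: "carrier (tensor_prod R (L\<lparr>carrier := U\<rparr>) M)
      = (\<lambda>c. (\<lambda>h. h + c) ` ?N') ` {c. Poly_Mapping.keys c \<subseteq> U \<times> carrier M}"
    unfolding tensor_prod_def FactGroup_def RCOSETS_def r_coset_def
    by (auto simp: image_iff free_Abelian_group_def)
  have "?N <#>\<^bsub>free_Abelian_group (carrier L \<times> carrier M)\<^esub> ((\<lambda>h. h + c) ` ?N') = (\<lambda>h. h + c) ` ?N" for c
  proof (intro equalityI subsetI)
    fix z assume "z \<in> ?N <#>\<^bsub>free_Abelian_group (carrier L \<times> carrier M)\<^esub> ((\<lambda>h. h + c) ` ?N')"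
    then obtain a b where "a \<in> ?N" "b \<in> ?N'" "z = a + (b + c)"
      by (auto simp: set_mult_def)
    moreover have "a + b \<in> ?N"
      using calculation tensor_rels_closed(3)[OF R] tensor_rels_submodule[OF R U] by blast
    ultimately show "z \<in> (\<lambda>h. h + c) ` ?N"
      by (intro image_eqI[of _ _ "a + b"]) (simp_all only: add.assoc)
  next
    fix z assume "z \<in> (\<lambda>h. h + c) ` ?N"
    then obtain a where "a \<in> ?N" "z = a + (0 + c)" by auto
    then show "z \<in> ?N <#>\<^bsub>free_Abelian_group (carrier L \<times> carrier M)\<^esub> ((\<lambda>h. h + c) ` ?N')"
      unfolding set_mult_def mult_free_Abelian_group using N' by blast
  qed
  then show ?thesis
    unfolding tensor_image_def carrier image_image by (intro image_cong refl)
qed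

lemma carrier_tensor_prod:
  "carrier (tensor_prod R L M) =
    (\<lambda>c. (\<lambda>h. h + c) ` tensor_rels R L M) ` {c. Poly_Mapping.keys c \<subseteq> carrier L \<times> carrier M}"
  unfolding tensor_prod_def FactGroup_def RCOSETS_def r_coset_def
  by (auto simp: image_iff free_Abelian_group_def)

lemma tensor_coset_eq_iff:
  assumes R: "module R L" "module R M"
  shows "(\<lambda>h. h + c) ` tensor_rels R L M = (\<lambda>h. h + d) ` tensor_rels R L M
    \<longleftrightarrow> c - d \<in> tensor_rels R L M"
proof
  assume "(\<lambda>h. h + c) ` tensor_rels R L M = (\<lambda>h. h + d) ` tensor_rels R L M"
  moreover have "0 + c \<in> (\<lambda>h. h + c) ` tensor_rels R L M"
    by (rule imageI[OF tensor_rels_closed(1)[OF R]])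
  ultimately obtain h where "h \<in> tensor_rels R L M" "c = h + d" by auto
  then show "c - d \<in> tensor_rels R L M" by simp
next
  assume cd: "c - d \<in> tensor_rels R L M"
  have "(\<lambda>h. h + a) ` tensor_rels R L M \<subseteq> (\<lambda>h. h + b) ` tensor_rels R L M"
    if ab: "a - b \<in> tensor_rels R L M" for a b
  proof safe
    fix h assume "h \<in> tensor_rels R L M"
    then have "h + (a - b) \<in> tensor_rels R L M" using tensor_rels_closed(3)[OF R] ab by blast
    then show "h + a \<in> (\<lambda>h. h + b) ` tensor_rels R L M"
      by (rule image_eqI[rotated]) simp
  qed
  moreover have "d - c \<in> tensor_rels R L M"
    using tensor_rels_closed(4)[OF R cd] by simp
  ultimately show "(\<lambda>h. h + c) ` tensor_rels R L M = (\<lambda>h. h + d) ` tensor_rels R L M"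
    using cd by (intro equalityI)
qed

text \<open>Cosets are replaced by representatives, so that flatness becomes a statement about
  formal sums modulo relations.\<close>

lemma intersection_flatI:
  assumes M: "module R M"
    and "\<And>(L :: ('r, 'l) module) \<U> c. finitely_generated_module R L \<Longrightarrow> \<U> \<noteq> {} \<Longrightarrow>
      (\<And>U. U \<in> \<U> \<Longrightarrow> submodule U R L) \<Longrightarrow> Poly_Mapping.keys c \<subseteq> carrier L \<times> carrier M \<Longrightarrow>
      (\<And>U. U \<in> \<U> \<Longrightarrow> \<exists>d. Poly_Mapping.keys d \<subseteq> U \<times> carrier M \<and> c - d \<in> tensor_rels R L M) \<Longrightarrow>
      submodule (\<Inter>\<U>) R L \<Longrightarrow>
      \<exists>d. Poly_Mapping.keys d \<subseteq> \<Inter>\<U> \<times> carrier M \<and> c - d \<in> tensor_rels R L M"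
  shows "intersection_flat TYPE('l) (R :: ('r, 'w) ring_scheme) (M :: ('r, 'm, 'z) module_scheme)"
  unfolding intersection_flat_def
proof (intro conjI allI impI M; elim conjE)
  fix L :: "('r, 'l) module" and \<U>
  assume fg: "finitely_generated_module R L" and sub: "\<forall>U\<in>\<U>. submodule U R L"
  have L: "module R L" using fg by (simp add: finitely_generated_module_def)
  note subE = module.submoduleE[OF L]
  let ?W = "carrier L \<inter> \<Inter>\<U>"
  have W: "submodule ?W R L"
  proof (rule module.submoduleI[OF L])
    have zero: "\<zero>\<^bsub>L\<^esub> \<in> U" if "submodule U R L" for U
      using subgroup.one_closed[OF submodule.axioms(1)[OF that]] by simp
    show "\<zero>\<^bsub>L\<^esub> \<in> ?W" using zero sub zero[OF module.carrier_is_submodule[OF L]] by blast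
    show "\<ominus>\<^bsub>L\<^esub> x \<in> ?W" if "x \<in> ?W" for x
      using that sub subE(3) subE(3)[OF module.carrier_is_submodule[OF L]] by blast
    show "x \<oplus>\<^bsub>L\<^esub> y \<in> ?W" if "x \<in> ?W" "y \<in> ?W" for x y
      using that sub subE(5) subE(5)[OF module.carrier_is_submodule[OF L]] by blast
    show "a \<odot>\<^bsub>L\<^esub> x \<in> ?W" if "a \<in> carrier R" "x \<in> ?W" for a x
      using that sub subE(4) subE(4)[OF module.carrier_is_submodule[OF L]] by blast
  qed blast
  let ?coset = "\<lambda>c. (\<lambda>h. h + c) ` tensor_rels R L M"
  show "tensor_image R L ?W M = carrier (tensor_prod R L M) \<inter> (\<Inter>U\<in>\<U>. tensor_image R L U M)"
  proof (intro equalityI subsetI IntI INT_I)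
    fix X assume "X \<in> tensor_image R L ?W M"
    then obtain c where c: "X = ?coset c" "Poly_Mapping.keys c \<subseteq> ?W \<times> carrier M"
      unfolding tensor_image_eq[OF L M W] by blast
    then have cL: "Poly_Mapping.keys c \<subseteq> carrier L \<times> carrier M" by blast
    show "X \<in> carrier (tensor_prod R L M)"
      unfolding carrier_tensor_prod c(1) by (rule imageI) (use cL in simp)
    fix U assume "U \<in> \<U>"
    then have cU: "Poly_Mapping.keys c \<subseteq> U \<times> carrier M" using c(2) by blast
    show "X \<in> tensor_image R L U M"
      unfolding tensor_image_eq[OF L M sub[rule_format, OF \<open>U \<in> \<U>\<close>]] c(1)
      by (rule imageI) (use cU in simp)
  next
    fix X assume X: "X \<in> carrier (tensor_prod R L M) \<inter> (\<Inter>U\<in>\<U>. tensor_image R L U M)"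
    then obtain c where c: "X = ?coset c" "Poly_Mapping.keys c \<subseteq> carrier L \<times> carrier M"
      unfolding carrier_tensor_prod by blast
    \<comment> \<open>Adjoining \<open>carrier L\<close> to the family makes it nonempty and
      accounts for the intersection being formed inside L.\<close>
    have ex: "\<exists>d. Poly_Mapping.keys d \<subseteq> U \<times> carrier M \<and> c - d \<in> tensor_rels R L M"
      if U: "U \<in> insert (carrier L) \<U>" for U
    proof (cases "U = carrier L")
      case True
      then show ?thesis using c(2) tensor_rels_closed(1)[OF L M] by (intro exI[of _ c]) simp
    next
      case False
      then have "U \<in> \<U>" using U by blast
      then have "X \<in> tensor_image R L U M" using X by blast
      then obtain d where "X = ?coset d" "Poly_Mapping.keys d \<subseteq> U \<times> carrier M"
        unfolding tensor_image_eq[OF L M sub[rule_format, OF \<open>U \<in> \<U>\<close>]] by blast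
      then show ?thesis using tensor_coset_eq_iff[OF L M, of c d] c(1) by (intro exI[of _ d]) simp
    qed
    have subs: "submodule U R L" if "U \<in> insert (carrier L) \<U>" for U
      using that sub module.carrier_is_submodule[OF L] by blast
    have "\<exists>d. Poly_Mapping.keys d \<subseteq> \<Inter>(insert (carrier L) \<U>) \<times> carrier M \<and> c - d \<in> tensor_rels R L M"
      using ex subs W by (intro assms(2)[OF fg insert_not_empty _ c(2)]) (simp_all only: Inter_insert)
    then obtain d where d: "Poly_Mapping.keys d \<subseteq> \<Inter>(insert (carrier L) \<U>) \<times> carrier M"
      "c - d \<in> tensor_rels R L M" by (elim exE conjE)
    then have "X = ?coset d" using tensor_coset_eq_iff[OF L M, of c d] c(1) by simp
    then show "X \<in> tensor_image R L ?W M"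
      unfolding tensor_image_eq[OF L M W] using d(1) by (intro image_eqI[of _ _ d]) simp_all
  qed
qed


section \<open>Comparison of tensor products with extended submodules\<close>

context presented_module
begin

abbreviation "M \<equiv> tate_algebra n \<phi>"

abbreviation "rels \<equiv> tensor_rels (tate_ring n) L M"

lemma modules: "module (tate_ring n) L" "module (tate_ring n) M"
  using L.module_axioms algebra.module[OF algebra_tate] .

lemmas rels_closed = tensor_rels_closed[OF modules]
  and rels_diff = tensor_rels_diff[OF modules]
  and rels_sum = tensor_rels_sum[OF modules]

lemma preimage_mono: "A \<subseteq> B \<Longrightarrow> preimage A \<subseteq> preimage B"
  unfolding preimage_def by blast

text \<open>\<open>push\<close> lifts \<open>x \<otimes> g\<close> to the vector \<open>g * lift x\<close> over the larger Tate algebra; \<open>pull\<close> sends a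
  vector \<open>v\<close> to \<open>\<Sum>j. s j \<otimes> v j\<close>.\<close>

definition push :: "('l \<times> 'c mseries \<Rightarrow>\<^sub>0 int) \<Rightarrow> 'c mseries" where
  "push c = (\<lambda>\<nu>. \<Sum>x\<in>Poly_Mapping.keys c.
     of_int (Poly_Mapping.lookup c x) * (snd x \<star> (\<phi> \<circ> lift (fst x))) \<nu>)"

definition pull :: "'c mseries \<Rightarrow> ('l \<times> 'c mseries \<Rightarrow>\<^sub>0 int)" where
  "pull v = (\<Sum>j<m. frag_of (s j, component n j v))"

lemma push_superset:
  assumes "finite S" "Poly_Mapping.keys c \<subseteq> S"
  shows "push c \<nu> = (\<Sum>x\<in>S. of_int (Poly_Mapping.lookup c x) * (snd x \<star> (\<phi> \<circ> lift (fst x))) \<nu>)"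
  unfolding push_def using assms by (intro sum.mono_neutral_left) (auto simp: in_keys_iff)

lemma push_add: "push (a + b) = push a + push b"
proof
  fix \<nu>
  let ?S = "Poly_Mapping.keys a \<union> Poly_Mapping.keys b"
  have S: "finite ?S" "Poly_Mapping.keys a \<subseteq> ?S" "Poly_Mapping.keys b \<subseteq> ?S"
    "Poly_Mapping.keys (a + b) \<subseteq> ?S"
    by (simp_all add: Poly_Mapping.keys_add)
  show "push (a + b) \<nu> = (push a + push b) \<nu>"
    unfolding plus_fun_apply push_superset[OF S(1,2)] push_superset[OF S(1,3)]
      push_superset[OF S(1,4)] lookup_add of_int_add distrib_right sum.distrib ..
qed

lemma push_zero: "push 0 = 0"
  by (simp add: push_def fun_eq_iff)

lemma push_diff: "push (a - b) = push a - push b"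
  using push_add[of "a - b" b] by (simp only: diff_add_cancel eq_diff_eq)

lemma push_uminus: "push (- a) = - push a"
  using push_diff[of 0 a] by (simp only: push_zero diff_0)

lemma push_frag_of: "push (frag_of (x, g)) = g \<star> (\<phi> \<circ> lift x)"
  by (simp add: push_def fun_eq_iff)

lemma ext_diff: "x \<in> ext n U \<Longrightarrow> y \<in> ext n U \<Longrightarrow> x - y \<in> ext n U"
  using ext.add[OF _ ext_uminus] by (simp only: diff_conv_add_uminus)

lemma push_ext:
  assumes "U \<subseteq> carrier L" and c: "Poly_Mapping.keys c \<subseteq> U \<times> carrier M"
  shows "push c \<in> ext n (preimage U)"
  using c
proof (induction c rule: frag_induction)
  case (one x)
  then obtain l g where x: "x = (l, g)" "l \<in> U" "g \<in> null_series (exps n)"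
    unfolding tate_algebra_simps by blast
  show ?case
    unfolding x(1) push_frag_of by (rule ext.conv[OF x(3) lift_preimage[OF assms(1) x(2)]])
next
  case (diff a b)
  then show ?case unfolding push_diff by (rule ext_diff)
qed (simp only: push_zero ext.zero)

lemma proj_diff: "u \<in> V \<Longrightarrow> v \<in> V \<Longrightarrow> proj (u - v) = proj u \<ominus>\<^bsub>L\<^esub> proj v"
  unfolding diff_conv_add_uminus
  by (simp only: proj_add null_series_uminus proj_uminus L.minus_eq)

text \<open>On a relation in the left argument or a balancing relation, \<open>push\<close> gives g
  times a failure of \<open>lift\<close> to be linear, which is in the kernel of
  \<open>proj\<close>. On a relation in the right argument it gives 0, being additive in g.\<close>

lemma push_rels: "c \<in> rels \<Longrightarrow> push c \<in> ext n (preimage {\<zero>\<^bsub>L\<^esub>})"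
proof -
  have gen: "push h \<in> ext n (preimage {\<zero>\<^bsub>L\<^esub>})" if "h \<in> tensor_gens (tate_ring n) L M" for h
    using that
  proof (cases rule: tensor_gensE)
    case (left x x' g)
    have x: "lift (x \<oplus>\<^bsub>L\<^esub> x') \<in> V" "lift x \<in> V" "lift x' \<in> V"
      using left lift(1) L.a_closed by blast+
    have "proj (lift (x \<oplus>\<^bsub>L\<^esub> x') - (lift x + lift x')) = \<zero>\<^bsub>L\<^esub>"
      using left x by (simp only: proj_diff proj_add null_series_add lift L.a_closed L.r_neg L.minus_eq)
    then have "lift (x \<oplus>\<^bsub>L\<^esub> x') - (lift x + lift x') \<in> preimage {\<zero>\<^bsub>L\<^esub>}"
      using x by (simp only: preimage_def mem_Collect_eq null_series_diff null_series_add singleton_iff)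
    then have "g \<star> (\<phi> \<circ> (lift (x \<oplus>\<^bsub>L\<^esub> x') - (lift x + lift x'))) \<in> ext n (preimage {\<zero>\<^bsub>L\<^esub>})"
      using left(3) unfolding tate_algebra_simps by (intro ext.conv)
    then show ?thesis
      unfolding left(4) push_diff push_frag_of
      by (simp only: hom_comp_diff hom_comp_add conv_diff_right conv_add_right diff_diff_eq)
  next
    case (right x g g')
    show ?thesis
      unfolding right(4) push_diff push_frag_of tate_algebra_simps conv_add_left
      by (simp only: add_diff_cancel_left' diff_self ext.zero)
  next
    case (scale r x g)
    have r: "r \<in> null_series (exps n)" using scale(1) unfolding carrier_tate_ring .
    have x: "lift (r \<odot>\<^bsub>L\<^esub> x) \<in> V" "lift x \<in> V" "r \<star> lift x \<in> V"
      using scale lift(1) L.smult_closed null_series_vexps_conv[OF r] by blast+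
    have "proj (lift (r \<odot>\<^bsub>L\<^esub> x) - r \<star> lift x) = \<zero>\<^bsub>L\<^esub>"
      using scale x r by (simp only: proj_diff proj_conv lift L.smult_closed L.r_neg L.minus_eq)
    then have "lift (r \<odot>\<^bsub>L\<^esub> x) - r \<star> lift x \<in> preimage {\<zero>\<^bsub>L\<^esub>}"
      using x by (simp only: preimage_def mem_Collect_eq null_series_diff singleton_iff)
    then have "g \<star> (\<phi> \<circ> (lift (r \<odot>\<^bsub>L\<^esub> x) - r \<star> lift x)) \<in> ext n (preimage {\<zero>\<^bsub>L\<^esub>})"
      using scale(3) unfolding tate_algebra_simps by (intro ext.conv)
    then show ?thesis
      unfolding scale(4) push_diff push_frag_of tate_algebra_simps hom_comp_diff hom_comp_conv
        conv_diff_right conv_assoc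
      by (simp only: conv_left_commute)
  qed
  assume "c \<in> rels"
  with modules show ?thesis
  proof (induction rule: tensor_rels_induct)
    case (add a b)
    then show ?case unfolding push_add by (rule ext.add)
  next
    case (neg h)
    from ext_uminus[OF gen[OF neg]] show ?case unfolding push_uminus .
  qed (simp_all only: push_zero ext.zero gen)
qed

lemma rels_left:
  assumes "x \<in> carrier L" "x' \<in> carrier L" "g \<in> null_series (exps n)"
  shows "frag_of (x \<oplus>\<^bsub>L\<^esub> x', g) - frag_of (x, g) - frag_of (x', g) \<in> rels"
  by (rule rels_closed(2)) (use assms in \<open>unfold tensor_gens_def tate_algebra_simps, blast\<close>)

lemma rels_right:
  assumes "x \<in> carrier L" "g \<in> null_series (exps n)" "g' \<in> null_series (exps n)"
  shows "frag_of (x, g + g') - frag_of (x, g) - frag_of (x, g') \<in> rels"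
  by (rule rels_closed(2)) (use assms in \<open>unfold tensor_gens_def tate_algebra_simps, blast\<close>)

lemma rels_scale:
  assumes "a \<in> null_series (exps n)" "x \<in> carrier L" "g \<in> null_series (exps n)"
  shows "frag_of (a \<odot>\<^bsub>L\<^esub> x, g) - frag_of (x, (\<phi> \<circ> a) \<star> g) \<in> rels"
  by (rule rels_closed(2))
    (use assms in \<open>unfold tensor_gens_def tate_algebra_simps carrier_tate_ring, blast\<close>)

lemma rels_zero_left: "g \<in> null_series (exps n) \<Longrightarrow> frag_of (\<zero>\<^bsub>L\<^esub>, g) \<in> rels"
  using rels_closed(4)[OF rels_left[OF L.zero_closed L.zero_closed, of g]] by simp

lemma rels_zero_right: "x \<in> carrier L \<Longrightarrow> frag_of (x, 0) \<in> rels"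
  using rels_closed(4)[OF rels_right[of x 0 0]]
  by (simp only: null_series_zero add_0_left diff_self diff_0 minus_minus)

lemma pull_zero: "pull 0 \<in> rels"
  unfolding pull_def component_zero by (intro rels_sum rels_zero_right s_closed) simp

text \<open>Additivity holds only modulo relations, since \<open>frag_of\<close> is not additive in
  its second entry.\<close>

lemma pull_add:
  assumes "u \<in> null_series X" "v \<in> null_series X"
  shows "pull (u + v) - pull u - pull v \<in> rels"
proof -
  have "pull (u + v) - pull u - pull v = (\<Sum>j<m. frag_of (s j, component n j u + component n j v)
      - frag_of (s j, component n j u) - frag_of (s j, component n j v))"
    unfolding pull_def component_add sum_subtractf ..
  also have "\<dots> \<in> rels"
    by (intro rels_sum rels_right s_closed null_series_component[OF assms(1)]
        null_series_component[OF assms(2)]) simp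
  finally show ?thesis .
qed

lemma pull_diff:
  assumes u: "u \<in> null_series X" and v: "v \<in> null_series X"
  shows "pull (u - v) - (pull u - pull v) \<in> rels"
proof -
  have "- (pull ((u - v) + v) - pull (u - v) - pull v) \<in> rels"
    by (intro rels_closed(4) pull_add[OF null_series_diff[OF u v] v])
  moreover have "- (pull ((u - v) + v) - pull (u - v) - pull v) = pull (u - v) - (pull u - pull v)"
    unfolding diff_add_cancel by (simp add: algebra_simps)
  ultimately show ?thesis by (simp only:)
qed

lemma rels_finsum:
  assumes "finite J" "x \<in> J \<rightarrow> carrier L" and g: "g \<in> null_series (exps n)"
  shows "(\<Sum>j\<in>J. frag_of (x j, g)) - frag_of (\<Oplus>\<^bsub>L\<^esub>j\<in>J. x j, g) \<in> rels"
  using assms(1,2)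
proof (induction J rule: finite_induct)
  case empty
  have "- frag_of (\<zero>\<^bsub>L\<^esub>, g) \<in> rels" by (rule rels_closed(4)[OF rels_zero_left[OF g]])
  then show ?case by simp
next
  case (insert i J)
  then have x: "x i \<in> carrier L" "x \<in> J \<rightarrow> carrier L" by auto
  then have y: "(\<Oplus>\<^bsub>L\<^esub>j\<in>J. x j) \<in> carrier L" by (intro L.finsum_closed)
  have eq: "(\<Oplus>\<^bsub>L\<^esub>j\<in>insert i J. x j) = x i \<oplus>\<^bsub>L\<^esub> (\<Oplus>\<^bsub>L\<^esub>j\<in>J. x j)"
    by (rule L.finsum_insert[OF insert.hyps x(2,1)])
  have "((\<Sum>j\<in>J. frag_of (x j, g)) - frag_of (\<Oplus>\<^bsub>L\<^esub>j\<in>J. x j, g))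
      - (frag_of (x i \<oplus>\<^bsub>L\<^esub> (\<Oplus>\<^bsub>L\<^esub>j\<in>J. x j), g) - frag_of (x i, g) - frag_of (\<Oplus>\<^bsub>L\<^esub>j\<in>J. x j, g)) \<in> rels"
    by (rule rels_diff[OF insert.IH[OF x(2)] rels_left[OF x(1) y g]])
  then show ?case
    unfolding eq sum.insert[OF insert.hyps] by (simp add: algebra_simps)
qed

text \<open>With a j the components of f, this is the computation that \<Sum>j. s j \<otimes>
  \<phi>(a j) g equals (\<Sum>j. a j s j) \<otimes> g, by balancing and additivity.\<close>

lemma pull_conv:
  assumes f: "f \<in> V" and g: "g \<in> null_series (exps n)"
  shows "pull (g \<star> (\<phi> \<circ> f)) - frag_of (proj f, g) \<in> rels"
proof -
  let ?a = "\<lambda>j. component n j f"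
  have a: "?a j \<in> null_series (exps n)" for j by (rule null_series_component[OF f])
  have comp: "component n j (g \<star> (\<phi> \<circ> f)) = (\<phi> \<circ> ?a j) \<star> g" for j
  proof -
    have "component n j (g \<star> (\<phi> \<circ> f)) = g \<star> component n j (\<phi> \<circ> f)"
      by (rule component_conv) (rule null_seriesD(1)[OF g])
    then show ?thesis unfolding component_hom by (simp only: conv_commute)
  qed
  have "(\<Sum>j<m. frag_of (?a j \<odot>\<^bsub>L\<^esub> s j, g) - frag_of (s j, (\<phi> \<circ> ?a j) \<star> g)) \<in> rels"
    by (intro rels_sum rels_scale a s_closed g) simp
  moreover have "(\<Sum>j<m. frag_of (?a j \<odot>\<^bsub>L\<^esub> s j, g)) - frag_of (proj f, g) \<in> rels"
    unfolding proj_def by (rule rels_finsum[OF finite_lessThan summand_closed[OF f] g])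
  ultimately have "(\<Sum>j<m. frag_of (?a j \<odot>\<^bsub>L\<^esub> s j, g)) - frag_of (proj f, g)
      - (\<Sum>j<m. frag_of (?a j \<odot>\<^bsub>L\<^esub> s j, g) - frag_of (s j, (\<phi> \<circ> ?a j) \<star> g)) \<in> rels"
    using rels_diff by blast
  then show ?thesis
    unfolding pull_def comp sum_subtractf by (simp add: algebra_simps)
qed

lemma push_null_series:
  "Poly_Mapping.keys c \<subseteq> carrier L \<times> carrier M \<Longrightarrow> push c \<in> null_series (vexps n m)"
  by (rule ext_null_series[OF series_submodule_preimage[OF L.carrier_is_submodule]
        push_ext[OF order_refl]])

text \<open>For a simple tensor this is \<open>pull_conv\<close> applied to \<open>lift l\<close>,
  which \<open>proj\<close> takes back to l.\<close>

lemma pull_push: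
  assumes "Poly_Mapping.keys c \<subseteq> carrier L \<times> carrier M"
  shows "c - pull (push c) \<in> rels"
proof -
  \<comment> \<open>The support is carried along because the induction step passes to differences,
    where \<open>pull_diff\<close> needs both parts to push to null series.\<close>
  have "Poly_Mapping.keys c \<subseteq> carrier L \<times> carrier M \<and> c - pull (push c) \<in> rels"
    using assms
  proof (induction c rule: frag_induction)
    case zero
    have "- pull 0 \<in> rels" by (rule rels_closed(4)[OF pull_zero])
    then show ?case by (simp only: push_zero diff_0 keys_zero empty_subsetI simp_thms)
  next
    case (one x)
    then obtain l g where x: "x = (l, g)" "l \<in> carrier L" "g \<in> null_series (exps n)"
      unfolding tate_algebra_simps by blast
    have "- (pull (g \<star> (\<phi> \<circ> lift l)) - frag_of (proj (lift l), g)) \<in> rels"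
      by (rule rels_closed(4)[OF pull_conv[OF lift(1)[OF x(2)] x(3)]])
    then show ?case
      using one unfolding x(1) push_frag_of lift(2)[OF x(2)] by simp
  next
    case (diff a b)
    then have a: "Poly_Mapping.keys a \<subseteq> carrier L \<times> carrier M" "a - pull (push a) \<in> rels"
      and b: "Poly_Mapping.keys b \<subseteq> carrier L \<times> carrier M" "b - pull (push b) \<in> rels"
      by blast+
    have "((a - pull (push a)) - (b - pull (push b)))
        - (pull (push a - push b) - (pull (push a) - pull (push b))) \<in> rels"
      by (rule rels_diff[OF rels_diff[OF a(2) b(2)]
            pull_diff[OF push_null_series[OF a(1)] push_null_series[OF b(1)]]])
    moreover have "(x - p) - (y - q) - (z - (p - q)) = x - y - z"
      for x y z p q :: "'l \<times> 'c mseries \<Rightarrow>\<^sub>0 int"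
      by (simp add: algebra_simps)
    ultimately have "a - b - pull (push (a - b)) \<in> rels" by (simp only: push_diff)
    then show ?case using keys_diff_subset[OF a(1) b(1)] by (intro conjI)
  qed
  then show ?thesis ..
qed

lemma pull_ext:
  assumes W: "submodule W (tate_ring n) L" and y: "y \<in> ext n (preimage W)"
  shows "\<exists>d. Poly_Mapping.keys d \<subseteq> W \<times> carrier M \<and> pull y - d \<in> rels"
  using y
proof induction
  case zero
  show ?case
    using pull_zero by (intro exI[of _ 0]) (simp only: diff_0_right keys_zero empty_subsetI simp_thms)
next
  case (conv g f)
  then have f: "f \<in> V" "proj f \<in> W" unfolding preimage_def by blast+
  have "Poly_Mapping.keys (frag_of (proj f, g)) \<subseteq> W \<times> carrier M"
    unfolding tate_algebra_simps using f(2) conv(1) by simp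
  then show ?case using pull_conv[OF f(1) conv(1)] by blast
next
  case (add x y)
  from add.IH obtain d e where d: "Poly_Mapping.keys d \<subseteq> W \<times> carrier M" "pull x - d \<in> rels"
    and e: "Poly_Mapping.keys e \<subseteq> W \<times> carrier M" "pull y - e \<in> rels"
    by (elim exE conjE)
  note null = ext_null_series[OF series_submodule_preimage[OF W]]
  have "(pull (x + y) - pull x - pull y) + ((pull x - d) + (pull y - e)) \<in> rels"
    by (intro rels_closed(3) pull_add[OF null[OF add.hyps(1)] null[OF add.hyps(2)]] d(2) e(2))
  moreover have "(pull (x + y) - pull x - pull y) + ((pull x - d) + (pull y - e))
      = pull (x + y) - (d + e)"
    by (simp add: algebra_simps)
  ultimately show ?case using keys_add_subset[OF d(1) e(1)] by metis
qed

text \<open>Writing c as (c - d) + d, the relation c - d pushes into the extended kernel of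
  \<open>proj\<close>, which every preimage contains, and d into the extended preimage of U. So
  \<open>ext_Inter\<close> applies to \<open>push c\<close>, and \<open>pull\<close> returns a
  representative supported on the intersection.\<close>

lemma tensor_Inter:
  assumes ne: "\<U> \<noteq> {}" and sub: "\<And>U. U \<in> \<U> \<Longrightarrow> submodule U (tate_ring n) L"
    and c: "Poly_Mapping.keys c \<subseteq> carrier L \<times> carrier M"
    and d: "\<And>U. U \<in> \<U> \<Longrightarrow> \<exists>d. Poly_Mapping.keys d \<subseteq> U \<times> carrier M \<and> c - d \<in> rels"
    and W: "submodule (\<Inter>\<U>) (tate_ring n) L"
  shows "\<exists>d. Poly_Mapping.keys d \<subseteq> \<Inter>\<U> \<times> carrier M \<and> c - d \<in> rels"
proof -
  have "push c \<in> ext n (preimage U)" if U: "U \<in> \<U>" for U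
  proof -
    note closed = submodule_closed[OF sub[OF U]]
    obtain d where d: "Poly_Mapping.keys d \<subseteq> U \<times> carrier M" "c - d \<in> rels"
      using d[OF U] by (elim exE conjE)
    have "preimage {\<zero>\<^bsub>L\<^esub>} \<subseteq> preimage U" using closed(2) by (intro preimage_mono) simp
    then have "push (c - d) \<in> ext n (preimage U)" by (rule ext_mono[OF push_rels[OF d(2)]])
    from ext.add[OF this push_ext[OF closed(1) d(1)]] show ?thesis
      unfolding push_diff diff_add_cancel .
  qed
  then have "push c \<in> ext n (\<Inter>(preimage ` \<U>))"
    using ne sub series_submodule_preimage by (intro ext_Inter) blast+
  also have "\<Inter>(preimage ` \<U>) = preimage (\<Inter>\<U>)"
    using ne unfolding preimage_def by blast
  finally obtain d where d: "Poly_Mapping.keys d \<subseteq> \<Inter>\<U> \<times> carrier M" "pull (push c) - d \<in> rels"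
    using pull_ext[OF W] by blast
  have "(c - pull (push c)) + (pull (push c) - d) \<in> rels"
    by (rule rels_closed(3)[OF pull_push[OF c] d(2)])
  then show ?thesis using d(1) by (intro exI[of _ d]) simp
qed

end

lemma (in na_embedding) intersection_flat_tate:
  "intersection_flat TYPE('l) (tate_ring n) (tate_algebra n \<phi>)"
proof (rule intersection_flatI)
  show "module (tate_ring n) (tate_algebra n \<phi>)"
    by (rule algebra.module[OF algebra_tate])
next
  fix L :: "('k mseries, 'l) module" and \<U> and c :: "'l \<times> 'c mseries \<Rightarrow>\<^sub>0 int"
  assume fg: "finitely_generated_module (tate_ring n) L" and *: "\<U> \<noteq> {}"
      "\<And>U. U \<in> \<U> \<Longrightarrow> submodule U (tate_ring n) L"
      "Poly_Mapping.keys c \<subseteq> carrier L \<times> carrier (tate_algebra n \<phi>)"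
      "\<And>U. U \<in> \<U> \<Longrightarrow> \<exists>d. Poly_Mapping.keys d \<subseteq> U \<times> carrier (tate_algebra n \<phi>) \<and>
         c - d \<in> tensor_rels (tate_ring n) L (tate_algebra n \<phi>)"
    and W: "submodule (\<Inter>\<U>) (tate_ring n) L"
  obtain S where S: "finite S" "S \<subseteq> carrier L"
    "\<And>N. submodule N (tate_ring n) L \<Longrightarrow> S \<subseteq> N \<Longrightarrow> N = carrier L" and L: "module (tate_ring n) L"
    using fg unfolding finitely_generated_module_def by blast
  obtain s and m :: nat where s: "S = s ` {..<m}"
    using S(1) by (metis finite_imp_nat_seg_image_inj_on lessThan_def)
  interpret module "tate_ring n" L by (rule L)
  interpret presented_module \<phi> n L m s
    by unfold_locales (use S s in auto)
  show "\<exists>d. Poly_Mapping.keys d \<subseteq> \<Inter>\<U> \<times> carrier (tate_algebra n \<phi>) \<and>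
      c - d \<in> tensor_rels (tate_ring n) L (tate_algebra n \<phi>)"
    by (rule tensor_Inter[OF *(1,2,3,4) W])
qed

theorem theorem5p25:
  fixes \<iota> :: "'k::na_field \<Rightarrow> 'a::{alg_closed_field, na_valued_field}"
    and \<kappa> :: "'a \<Rightarrow> 'c::na_field"
    and n :: nat
  assumes "is_algebraic_closure \<iota>"
    and "\<forall>x. na_abs (\<iota> x) = na_abs x"
    and "is_completion \<kappa>"
    and "n > 0"
  shows "algebra (tate_ring n) (tate_algebra n (\<kappa> \<circ> \<iota>)) \<and>
    intersection_flat TYPE('l) (tate_ring n) (tate_algebra n (\<kappa> \<circ> \<iota>))"
proof -
  interpret na_embedding "\<kappa> \<circ> \<iota>"
    using assms by unfold_locales
      (auto simp: is_algebraic_closure_def is_completion_def field_hom_def)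
  show ?thesis using algebra_tate intersection_flat_tate by blast
qed

end
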